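(* Let $\mathbb T=(\mathbb T,\eta^{\mathbb T},\mu^{\mathbb T})$ be a strict 2-monad on a strict 2-category $\mathcal K$ and $\mathbb R=(\mathbb R,\eta^{\mathbb R},\mu^{\mathbb R})$ a strict 2-monad on a strict 2-category $\mathcal L$. Every colax morphism $(V,\lambda)$ of 2-monads from $\mathbb T$ to $\mathbb R$ induces a 2-functor $$\lambda^*_{\mathrm{ps}}\colon\mathbf{PsAlg}(\mathbb T)\longrightarrow\mathbf{PsAlg}(\mathbb R)$$ over $V$. It sends a pseudoaction $(a,\iota,\chi)$ on $X$ to the action $c_X:=Va\,\lambda_X\colon\mathbb R(VX)\to VX$. Its unit cell is $V\iota$, using $\lambda_X\eta^{\mathbb R}_{VX}=V\eta^{\mathbb T}_X$. With $\Lambda_X:=\lambda_{\mathbb TX}\,\mathbb R\lambda_X$, its multiplication cell is the composite $$c_X\,\mathbb Rc_X=Va\,V(\mathbb Ta)\,\Lambda_X\xRightarrow{\ V\chi\,\Lambda_X\ }Va\,V\mu^{\mathbb T}_X\,\Lambda_X=c_X\,\mu^{\mathbb R}_{VX}.$$ For a pseudomorphism $f\colon(X,a)\to(Y,b)$ with comparison $\overline f\colon b\,\mathbb Tf\Rightarrow fa$, the restricted comparison is $$Vb\,\lambda_Y\,\mathbb R(Vf)=Vb\,V(\mathbb Tf)\,\lambda_X\xRightarrow{\ V\overline f\,\lambda_X\ }Vf\,Va\,\lambda_X.$$ Algebra transformations are sent by $V$. Normal pseudoalgebras are sent to normal pseudoalgebras.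
   Context: A colax morphism of 2-monads from $\mathbb T$ on $\mathcal K$ to $\mathbb R$ on $\mathcal L$ consists of a strict 2-functor $V\colon\mathcal K\to\mathcal L$ and a 2-natural transformation $\lambda\colon\mathbb RV\Rightarrow V\mathbb T$ such that for every $X\in\mathcal K$: $\lambda_X\eta^{\mathbb R}_{VX}=V\eta^{\mathbb T}_X$ and $\lambda_X\mu^{\mathbb R}_{VX}=V\mu^{\mathbb T}_X\,\lambda_{\mathbb TX}\,\mathbb R\lambda_X$. Juxtaposition denotes whiskering, and products of parenthesized 2-cells denote vertical composition, right to left. A pseudo-$\mathbb T$-algebra is a 1-cell $a\colon\mathbb TX\to X$ with invertible 2-cells $\iota\colon1_X\Rightarrow a\eta_X$, $\chi\colon a\,\mathbb Ta\Rightarrow a\mu_X$ such that $(\chi\,\mathbb T\eta_X)(a\,\mathbb T\iota)=1_a$, $(\chi\,\eta_{\mathbb TX})(\iota a)=1_a$, $(\chi\,\mathbb T\mu_X)(a\,\mathbb T\chi)=(\chi\,\mu_{\mathbb TX})(\chi\,\mathbb T^2a)$. It is normal if $\iota$ is an identity. A pseudomorphism $(X,a,\iota^a,\chi^a)\to(Y,b,\iota^b,\chi^b)$ is a 1-cell $f\colon X\to Y$ with an invertible 2-cell $\overline f\colon b\,\mathbb Tf\Rightarrow fa$ such that $(\overline f\,\eta_X)(\iota^bf)=f\iota^a$ and $(\overline f\,\mu_X)(\chi^b\,\mathbb T^2f)=(f\chi^a)(\overline f\,\mathbb Ta)(b\,\mathbb T\overline f)$. An algebra transformation $(f,\overline f)\Rightarrow(g,\overline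 g)$ is a 2-cell $\alpha\colon f\Rightarrow g$ with $(\alpha a)\overline f=\overline g(b\,\mathbb T\alpha)$. These form the 2-category $\mathbf{PsAlg}(\mathbb T)$. "Over $V$" means that the composite with the forgetful 2-functor $\mathbf{PsAlg}(\mathbb R)\to\mathcal L$ equals $V$ composed with the forgetful 2-functor $\mathbf{PsAlg}(\mathbb T)\to\mathcal K$. *)

theory Defs
  imports Main
begin

section \<open>Strict 2-categories\<close>

text \<open>
  A 2-category is given by carriers of objects, 1-cells and 2-cells; the operations are total
  functions whose values matter only on composable arguments. All composites are written in
  function order: in \<open>g \<odot> f\<close>, \<open>\<beta> \<cdot> \<alpha>\<close> (vertical) and \<open>\<beta> \<star> \<alpha>\<close> (horizontal) the right-hand
  factor comes first.
\<close>

record ('o, 'm, 'c) two_cat =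
  obj :: "'o set"
  cell1 :: "'m set"
  cell2 :: "'c set"
  dom1 :: "'m \<Rightarrow> 'o"
  cod1 :: "'m \<Rightarrow> 'o"
  dom2 :: "'c \<Rightarrow> 'm"
  cod2 :: "'c \<Rightarrow> 'm"
  id1 :: "'o \<Rightarrow> 'm"
  comp1 :: "'m \<Rightarrow> 'm \<Rightarrow> 'm"  (infixr "\<odot>\<index>" 75)
  id2 :: "'m \<Rightarrow> 'c"
  vcomp :: "'c \<Rightarrow> 'c \<Rightarrow> 'c"  (infixr "\<cdot>\<index>" 65)
  hcomp :: "'c \<Rightarrow> 'c \<Rightarrow> 'c"  (infixr "\<star>\<index>" 70)

definition hom1 :: "('o, 'm, 'c) two_cat \<Rightarrow> 'o \<Rightarrow> 'o \<Rightarrow> 'm set" where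
  "hom1 C X Y = {f \<in> cell1 C. dom1 C f = X \<and> cod1 C f = Y}"

definition hom2 :: "('o, 'm, 'c) two_cat \<Rightarrow> 'm \<Rightarrow> 'm \<Rightarrow> 'c set" where
  "hom2 C f g = {\<alpha> \<in> cell2 C. dom2 C \<alpha> = f \<and> cod2 C \<alpha> = g}"

abbreviation whisker_left :: "'m \<Rightarrow> ('o, 'm, 'c) two_cat \<Rightarrow> 'c \<Rightarrow> 'c"  ("_ \<rhd>\<^bsub>_\<^esub> _" [73, 0, 72] 72) where
  "g \<rhd>\<^bsub>C\<^esub> \<alpha> \<equiv> id2 C g \<star>\<^bsub>C\<^esub> \<alpha>"

abbreviation whisker_right :: "'c \<Rightarrow> ('o, 'm, 'c) two_cat \<Rightarrow> 'm \<Rightarrow> 'c"  ("_ \<lhd>\<^bsub>_\<^esub> _" [72, 0, 73] 72) where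
  "\<alpha> \<lhd>\<^bsub>C\<^esub> f \<equiv> \<alpha> \<star>\<^bsub>C\<^esub> id2 C f"

locale two_category =
  fixes C :: "('o, 'm, 'c) two_cat" (structure)
  assumes dom1_obj: "f \<in> cell1 C \<Longrightarrow> dom1 C f \<in> obj C"
    and cod1_obj: "f \<in> cell1 C \<Longrightarrow> cod1 C f \<in> obj C"
    and dom2_cell1: "\<alpha> \<in> cell2 C \<Longrightarrow> dom2 C \<alpha> \<in> cell1 C"
    and cod2_cell1: "\<alpha> \<in> cell2 C \<Longrightarrow> cod2 C \<alpha> \<in> cell1 C"
    and globular_dom: "\<alpha> \<in> cell2 C \<Longrightarrow> dom1 C (dom2 C \<alpha>) = dom1 C (cod2 C \<alpha>)"
    and globular_cod: "\<alpha> \<in> cell2 C \<Longrightarrow> cod1 C (dom2 C \<alpha>) = cod1 C (cod2 C \<alpha>)"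
    and id1_hom: "X \<in> obj C \<Longrightarrow> id1 C X \<in> hom1 C X X"
    and comp1_hom: "f \<in> hom1 C X Y \<Longrightarrow> g \<in> hom1 C Y Z \<Longrightarrow> g \<odot> f \<in> hom1 C X Z"
    and comp1_id_left: "f \<in> hom1 C X Y \<Longrightarrow> id1 C Y \<odot> f = f"
    and comp1_id_right: "f \<in> hom1 C X Y \<Longrightarrow> f \<odot> id1 C X = f"
    and comp1_assoc: "f \<in> hom1 C W X \<Longrightarrow> g \<in> hom1 C X Y \<Longrightarrow> h \<in> hom1 C Y Z
      \<Longrightarrow> (h \<odot> g) \<odot> f = h \<odot> (g \<odot> f)"
    and id2_hom: "f \<in> cell1 C \<Longrightarrow> id2 C f \<in> hom2 C f f"
    and vcomp_hom: "\<alpha> \<in> hom2 C f g \<Longrightarrow> \<beta> \<in> hom2 C g h \<Longrightarrow> \<beta> \<cdot> \<alpha> \<in> hom2 C f h"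
    and vcomp_id_left: "\<alpha> \<in> hom2 C f g \<Longrightarrow> id2 C g \<cdot> \<alpha> = \<alpha>"
    and vcomp_id_right: "\<alpha> \<in> hom2 C f g \<Longrightarrow> \<alpha> \<cdot> id2 C f = \<alpha>"
    and vcomp_assoc: "\<alpha> \<in> hom2 C f g \<Longrightarrow> \<beta> \<in> hom2 C g h \<Longrightarrow> \<gamma> \<in> hom2 C h k
      \<Longrightarrow> (\<gamma> \<cdot> \<beta>) \<cdot> \<alpha> = \<gamma> \<cdot> (\<beta> \<cdot> \<alpha>)"
    and hcomp_hom: "f \<in> hom1 C X Y \<Longrightarrow> h \<in> hom1 C Y Z \<Longrightarrow> \<alpha> \<in> hom2 C f g \<Longrightarrow> \<beta> \<in> hom2 C h k
      \<Longrightarrow> \<beta> \<star> \<alpha> \<in> hom2 C (h \<odot> f) (k \<odot> g)"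
    and hcomp_id_left: "f \<in> hom1 C X Y \<Longrightarrow> \<alpha> \<in> hom2 C f g \<Longrightarrow> id2 C (id1 C Y) \<star> \<alpha> = \<alpha>"
    and hcomp_id_right: "f \<in> hom1 C X Y \<Longrightarrow> \<alpha> \<in> hom2 C f g \<Longrightarrow> \<alpha> \<star> id2 C (id1 C X) = \<alpha>"
    and hcomp_assoc: "f \<in> hom1 C W X \<Longrightarrow> h \<in> hom1 C X Y \<Longrightarrow> k \<in> hom1 C Y Z
      \<Longrightarrow> \<alpha> \<in> hom2 C f f' \<Longrightarrow> \<beta> \<in> hom2 C h h' \<Longrightarrow> \<gamma> \<in> hom2 C k k'
      \<Longrightarrow> (\<gamma> \<star> \<beta>) \<star> \<alpha> = \<gamma> \<star> (\<beta> \<star> \<alpha>)"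
    and hcomp_id2: "f \<in> hom1 C X Y \<Longrightarrow> g \<in> hom1 C Y Z \<Longrightarrow> id2 C g \<star> id2 C f = id2 C (g \<odot> f)"
    and interchange: "f \<in> hom1 C X Y \<Longrightarrow> k \<in> hom1 C Y Z
      \<Longrightarrow> \<alpha> \<in> hom2 C f g \<Longrightarrow> \<beta> \<in> hom2 C g h \<Longrightarrow> \<gamma> \<in> hom2 C k l \<Longrightarrow> \<delta> \<in> hom2 C l m
      \<Longrightarrow> (\<delta> \<cdot> \<gamma>) \<star> (\<beta> \<cdot> \<alpha>) = (\<delta> \<star> \<beta>) \<cdot> (\<gamma> \<star> \<alpha>)"

definition invertible2 :: "('o, 'm, 'c) two_cat \<Rightarrow> 'c \<Rightarrow> bool" where
  "invertible2 C \<alpha> \<longleftrightarrow> \<alpha> \<in> cell2 C \<and>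
     (\<exists>\<beta> \<in> hom2 C (cod2 C \<alpha>) (dom2 C \<alpha>).
        \<beta> \<cdot>\<^bsub>C\<^esub> \<alpha> = id2 C (dom2 C \<alpha>) \<and> \<alpha> \<cdot>\<^bsub>C\<^esub> \<beta> = id2 C (cod2 C \<alpha>))"

section \<open>Strict 2-functors and 2-natural transformations\<close>

record ('o, 'm, 'c, 'p, 'n, 'd) two_map =
  on0 :: "'o \<Rightarrow> 'p"
  on1 :: "'m \<Rightarrow> 'n"
  on2 :: "'c \<Rightarrow> 'd"

definition id_map :: "('o, 'm, 'c, 'o, 'm, 'c) two_map" where
  "id_map = \<lparr>on0 = (\<lambda>X. X), on1 = (\<lambda>f. f), on2 = (\<lambda>\<alpha>. \<alpha>)\<rparr>"

definition comp_map ::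
  "('p, 'n, 'd, 'q, 'k, 'e) two_map \<Rightarrow> ('o, 'm, 'c, 'p, 'n, 'd) two_map
    \<Rightarrow> ('o, 'm, 'c, 'q, 'k, 'e) two_map" where
  "comp_map G F = \<lparr>on0 = on0 G \<circ> on0 F, on1 = on1 G \<circ> on1 F, on2 = on2 G \<circ> on2 F\<rparr>"

text \<open>Equality of 2-functors out of \<open>C\<close>; values outside the carriers are irrelevant.\<close>

definition map_eq_on ::
  "('o, 'm, 'c) two_cat \<Rightarrow> ('o, 'm, 'c, 'p, 'n, 'd) two_map \<Rightarrow> ('o, 'm, 'c, 'p, 'n, 'd) two_map
    \<Rightarrow> bool" where
  "map_eq_on C F G \<longleftrightarrow>
     (\<forall>X \<in> obj C. on0 F X = on0 G X) \<and>
     (\<forall>f \<in> cell1 C. on1 F f = on1 G f) \<and>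
     (\<forall>\<alpha> \<in> cell2 C. on2 F \<alpha> = on2 G \<alpha>)"

locale two_functor = C: two_category C + D: two_category D
  for C :: "('o, 'm, 'c) two_cat" and D :: "('p, 'n, 'd) two_cat" +
  fixes F :: "('o, 'm, 'c, 'p, 'n, 'd) two_map"
  assumes on0_obj: "X \<in> obj C \<Longrightarrow> on0 F X \<in> obj D"
    and on1_hom: "f \<in> hom1 C X Y \<Longrightarrow> on1 F f \<in> hom1 D (on0 F X) (on0 F Y)"
    and on2_hom: "\<alpha> \<in> hom2 C f g \<Longrightarrow> on2 F \<alpha> \<in> hom2 D (on1 F f) (on1 F g)"
    and on1_id: "X \<in> obj C \<Longrightarrow> on1 F (id1 C X) = id1 D (on0 F X)"
    and on1_comp: "f \<in> hom1 C X Y \<Longrightarrow> g \<in> hom1 C Y Z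
      \<Longrightarrow> on1 F (g \<odot>\<^bsub>C\<^esub> f) = on1 F g \<odot>\<^bsub>D\<^esub> on1 F f"
    and on2_id: "f \<in> cell1 C \<Longrightarrow> on2 F (id2 C f) = id2 D (on1 F f)"
    and on2_vcomp: "\<alpha> \<in> hom2 C f g \<Longrightarrow> \<beta> \<in> hom2 C g h
      \<Longrightarrow> on2 F (\<beta> \<cdot>\<^bsub>C\<^esub> \<alpha>) = on2 F \<beta> \<cdot>\<^bsub>D\<^esub> on2 F \<alpha>"
    and on2_hcomp: "f \<in> hom1 C X Y \<Longrightarrow> h \<in> hom1 C Y Z \<Longrightarrow> \<alpha> \<in> hom2 C f g \<Longrightarrow> \<beta> \<in> hom2 C h k
      \<Longrightarrow> on2 F (\<beta> \<star>\<^bsub>C\<^esub> \<alpha>) = on2 F \<beta> \<star>\<^bsub>D\<^esub> on2 F \<alpha>"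

locale two_natural = F: two_functor C D F + G: two_functor C D G
  for C :: "('o, 'm, 'c) two_cat" and D :: "('p, 'n, 'd) two_cat"
    and F :: "('o, 'm, 'c, 'p, 'n, 'd) two_map" and G :: "('o, 'm, 'c, 'p, 'n, 'd) two_map" +
  fixes \<tau> :: "'o \<Rightarrow> 'n"
  assumes component_hom: "X \<in> obj C \<Longrightarrow> \<tau> X \<in> hom1 D (on0 F X) (on0 G X)"
    and natural1: "f \<in> hom1 C X Y \<Longrightarrow> on1 G f \<odot>\<^bsub>D\<^esub> \<tau> X = \<tau> Y \<odot>\<^bsub>D\<^esub> on1 F f"
    and natural2: "f \<in> hom1 C X Y \<Longrightarrow> \<alpha> \<in> hom2 C f g
      \<Longrightarrow> on2 G \<alpha> \<lhd>\<^bsub>D\<^esub> \<tau> X = \<tau> Y \<rhd>\<^bsub>D\<^esub> on2 F \<alpha>"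

section \<open>2-monads and their colax morphisms\<close>

record ('o, 'm, 'c) monad_data =
  endo :: "('o, 'm, 'c, 'o, 'm, 'c) two_map"
  eta :: "'o \<Rightarrow> 'm"
  mu :: "'o \<Rightarrow> 'm"

locale two_monad =
  endo: two_functor K K "endo T" +
  unit: two_natural K K id_map "endo T" "eta T" +
  mult: two_natural K K "comp_map (endo T) (endo T)" "endo T" "mu T"
  for K :: "('o, 'm, 'c) two_cat" and T :: "('o, 'm, 'c) monad_data" +
  assumes mu_endo_eta: "X \<in> obj K
      \<Longrightarrow> mu T X \<odot>\<^bsub>K\<^esub> on1 (endo T) (eta T X) = id1 K (on0 (endo T) X)"
    and mu_eta_endo: "X \<in> obj K
      \<Longrightarrow> mu T X \<odot>\<^bsub>K\<^esub> eta T (on0 (endo T) X) = id1 K (on0 (endo T) X)"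
    and mu_assoc: "X \<in> obj K
      \<Longrightarrow> mu T X \<odot>\<^bsub>K\<^esub> on1 (endo T) (mu T X) = mu T X \<odot>\<^bsub>K\<^esub> mu T (on0 (endo T) X)"

locale colax_monad_morphism =
  S: two_monad K T + R: two_monad L R +
  V: two_functor K L V +
  lam: two_natural K L "comp_map (endo R) V" "comp_map V (endo T)" lam
  for K :: "('o, 'm, 'c) two_cat" and T :: "('o, 'm, 'c) monad_data"
    and L :: "('p, 'n, 'd) two_cat" and R :: "('p, 'n, 'd) monad_data"
    and V :: "('o, 'm, 'c, 'p, 'n, 'd) two_map" and lam :: "'o \<Rightarrow> 'n" +
  assumes colax_unit: "X \<in> obj K \<Longrightarrow> lam X \<odot>\<^bsub>L\<^esub> eta R (on0 V X) = on1 V (eta T X)"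
    and colax_mult: "X \<in> obj K
      \<Longrightarrow> lam X \<odot>\<^bsub>L\<^esub> mu R (on0 V X)
          = on1 V (mu T X) \<odot>\<^bsub>L\<^esub> lam (on0 (endo T) X) \<odot>\<^bsub>L\<^esub> on1 (endo R) (lam X)"

section \<open>Pseudoalgebras, pseudomorphisms and algebra transformations\<close>

record ('o, 'm, 'c) psalg =
  base_ob :: 'o
  act :: 'm
  unit_cell :: 'c
  mult_cell :: 'c

definition is_psalg ::
  "('o, 'm, 'c) two_cat \<Rightarrow> ('o, 'm, 'c) monad_data \<Rightarrow> ('o, 'm, 'c) psalg \<Rightarrow> bool" where
  "is_psalg K T A \<longleftrightarrow>
     (let X = base_ob A; a = act A; \<iota> = unit_cell A; \<chi> = mult_cell A;
          T0 = on0 (endo T); T1 = on1 (endo T); T2 = on2 (endo T) in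
      X \<in> obj K \<and>
      a \<in> hom1 K (T0 X) X \<and>
      \<iota> \<in> hom2 K (id1 K X) (a \<odot>\<^bsub>K\<^esub> eta T X) \<and> invertible2 K \<iota> \<and>
      \<chi> \<in> hom2 K (a \<odot>\<^bsub>K\<^esub> T1 a) (a \<odot>\<^bsub>K\<^esub> mu T X) \<and> invertible2 K \<chi> \<and>
      (\<chi> \<lhd>\<^bsub>K\<^esub> T1 (eta T X)) \<cdot>\<^bsub>K\<^esub> (a \<rhd>\<^bsub>K\<^esub> T2 \<iota>) = id2 K a \<and>
      (\<chi> \<lhd>\<^bsub>K\<^esub> eta T (T0 X)) \<cdot>\<^bsub>K\<^esub> (\<iota> \<lhd>\<^bsub>K\<^esub> a) = id2 K a \<and>
      (\<chi> \<lhd>\<^bsub>K\<^esub> T1 (mu T X)) \<cdot>\<^bsub>K\<^esub> (a \<rhd>\<^bsub>K\<^esub> T2 \<chi>)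
        = (\<chi> \<lhd>\<^bsub>K\<^esub> mu T (T0 X)) \<cdot>\<^bsub>K\<^esub> (\<chi> \<lhd>\<^bsub>K\<^esub> T1 (T1 a)))"

definition normal_psalg ::
  "('o, 'm, 'c) two_cat \<Rightarrow> ('o, 'm, 'c) monad_data \<Rightarrow> ('o, 'm, 'c) psalg \<Rightarrow> bool" where
  "normal_psalg K T A \<longleftrightarrow> is_psalg K T A \<and> (\<exists>f \<in> cell1 K. unit_cell A = id2 K f)"

text \<open>
  Morphisms and transformations carry their source and target, so that these are functions of
  the cell in the 2-category \<open>PsAlg\<close> below.
\<close>

record ('o, 'm, 'c) psmor =
  msrc :: "('o, 'm, 'c) psalg"
  mmap :: 'm
  mcell :: 'c
  mtrg :: "('o, 'm, 'c) psalg"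

definition is_psmor ::
  "('o, 'm, 'c) two_cat \<Rightarrow> ('o, 'm, 'c) monad_data \<Rightarrow> ('o, 'm, 'c) psmor \<Rightarrow> bool" where
  "is_psmor K T p \<longleftrightarrow>
     (let X = base_ob (msrc p); a = act (msrc p);
          \<iota>a = unit_cell (msrc p); \<chi>a = mult_cell (msrc p);
          Y = base_ob (mtrg p); b = act (mtrg p);
          \<iota>b = unit_cell (mtrg p); \<chi>b = mult_cell (mtrg p);
          f = mmap p; \<phi> = mcell p;
          T1 = on1 (endo T); T2 = on2 (endo T) in
      is_psalg K T (msrc p) \<and> is_psalg K T (mtrg p) \<and>
      f \<in> hom1 K X Y \<and>
      \<phi> \<in> hom2 K (b \<odot>\<^bsub>K\<^esub> T1 f) (f \<odot>\<^bsub>K\<^esub> a) \<and> invertible2 K \<phi> \<and>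
      (\<phi> \<lhd>\<^bsub>K\<^esub> eta T X) \<cdot>\<^bsub>K\<^esub> (\<iota>b \<lhd>\<^bsub>K\<^esub> f) = f \<rhd>\<^bsub>K\<^esub> \<iota>a \<and>
      (\<phi> \<lhd>\<^bsub>K\<^esub> mu T X) \<cdot>\<^bsub>K\<^esub> (\<chi>b \<lhd>\<^bsub>K\<^esub> T1 (T1 f))
        = (f \<rhd>\<^bsub>K\<^esub> \<chi>a) \<cdot>\<^bsub>K\<^esub> (\<phi> \<lhd>\<^bsub>K\<^esub> T1 a) \<cdot>\<^bsub>K\<^esub> (b \<rhd>\<^bsub>K\<^esub> T2 \<phi>))"

record ('o, 'm, 'c) algtrans =
  tsrc :: "('o, 'm, 'c) psmor"
  tcell :: 'c
  ttrg :: "('o, 'm, 'c) psmor"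

definition is_algtrans ::
  "('o, 'm, 'c) two_cat \<Rightarrow> ('o, 'm, 'c) monad_data \<Rightarrow> ('o, 'm, 'c) algtrans \<Rightarrow> bool" where
  "is_algtrans K T t \<longleftrightarrow>
     (let p = tsrc t; q = ttrg t; \<alpha> = tcell t; a = act (msrc p); b = act (mtrg p) in
      is_psmor K T p \<and> is_psmor K T q \<and> msrc p = msrc q \<and> mtrg p = mtrg q \<and>
      \<alpha> \<in> hom2 K (mmap p) (mmap q) \<and>
      (\<alpha> \<lhd>\<^bsub>K\<^esub> a) \<cdot>\<^bsub>K\<^esub> mcell p = mcell q \<cdot>\<^bsub>K\<^esub> (b \<rhd>\<^bsub>K\<^esub> on2 (endo T) \<alpha>))"

definition id_psmor :: "('o, 'm, 'c) two_cat \<Rightarrow> ('o, 'm, 'c) psalg \<Rightarrow> ('o, 'm, 'c) psmor" where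
  "id_psmor K A = \<lparr>msrc = A, mmap = id1 K (base_ob A), mcell = id2 K (act A), mtrg = A\<rparr>"

text \<open>The comparison of a composite is \<open>c T(g f) = c Tg Tf \<Rightarrow> g b Tf \<Rightarrow> g f a\<close>.\<close>

definition comp_psmor ::
  "('o, 'm, 'c) two_cat \<Rightarrow> ('o, 'm, 'c) monad_data
    \<Rightarrow> ('o, 'm, 'c) psmor \<Rightarrow> ('o, 'm, 'c) psmor \<Rightarrow> ('o, 'm, 'c) psmor" where
  "comp_psmor K T q p =
     \<lparr>msrc = msrc p,
      mmap = mmap q \<odot>\<^bsub>K\<^esub> mmap p,
      mcell = (mmap q \<rhd>\<^bsub>K\<^esub> mcell p) \<cdot>\<^bsub>K\<^esub> (mcell q \<lhd>\<^bsub>K\<^esub> on1 (endo T) (mmap p)),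
      mtrg = mtrg q\<rparr>"

definition PsAlg ::
  "('o, 'm, 'c) two_cat \<Rightarrow> ('o, 'm, 'c) monad_data
    \<Rightarrow> (('o, 'm, 'c) psalg, ('o, 'm, 'c) psmor, ('o, 'm, 'c) algtrans) two_cat" where
  "PsAlg K T =
     \<lparr>obj = {A. is_psalg K T A},
      cell1 = {p. is_psmor K T p},
      cell2 = {t. is_algtrans K T t},
      dom1 = msrc, cod1 = mtrg,
      dom2 = tsrc, cod2 = ttrg,
      id1 = id_psmor K,
      comp1 = comp_psmor K T,
      id2 = (\<lambda>p. \<lparr>tsrc = p, tcell = id2 K (mmap p), ttrg = p\<rparr>),
      vcomp = (\<lambda>t s. \<lparr>tsrc = tsrc s, tcell = tcell t \<cdot>\<^bsub>K\<^esub> tcell s, ttrg = ttrg t\<rparr>),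
      hcomp = (\<lambda>t s. \<lparr>tsrc = comp_psmor K T (tsrc t) (tsrc s),
                      tcell = tcell t \<star>\<^bsub>K\<^esub> tcell s,
                      ttrg = comp_psmor K T (ttrg t) (ttrg s)\<rparr>)\<rparr>"

definition forget ::
  "(('o, 'm, 'c) psalg, ('o, 'm, 'c) psmor, ('o, 'm, 'c) algtrans, 'o, 'm, 'c) two_map" where
  "forget = \<lparr>on0 = base_ob, on1 = mmap, on2 = tcell\<rparr>"

section \<open>Restriction along a colax morphism\<close>

definition restrict_psalg ::
  "('o, 'm, 'c) monad_data \<Rightarrow> ('p, 'n, 'd) two_cat \<Rightarrow> ('p, 'n, 'd) monad_data
    \<Rightarrow> ('o, 'm, 'c, 'p, 'n, 'd) two_map \<Rightarrow> ('o \<Rightarrow> 'n)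
    \<Rightarrow> ('o, 'm, 'c) psalg \<Rightarrow> ('p, 'n, 'd) psalg" where
  "restrict_psalg T L R V lam A =
     \<lparr>base_ob = on0 V (base_ob A),
      act = on1 V (act A) \<odot>\<^bsub>L\<^esub> lam (base_ob A),
      unit_cell = on2 V (unit_cell A),
      mult_cell = on2 V (mult_cell A)
        \<lhd>\<^bsub>L\<^esub> (lam (on0 (endo T) (base_ob A)) \<odot>\<^bsub>L\<^esub> on1 (endo R) (lam (base_ob A)))\<rparr>"

definition restrict_psmor ::
  "('o, 'm, 'c) monad_data \<Rightarrow> ('p, 'n, 'd) two_cat \<Rightarrow> ('p, 'n, 'd) monad_data
    \<Rightarrow> ('o, 'm, 'c, 'p, 'n, 'd) two_map \<Rightarrow> ('o \<Rightarrow> 'n)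
    \<Rightarrow> ('o, 'm, 'c) psmor \<Rightarrow> ('p, 'n, 'd) psmor" where
  "restrict_psmor T L R V lam p =
     \<lparr>msrc = restrict_psalg T L R V lam (msrc p),
      mmap = on1 V (mmap p),
      mcell = on2 V (mcell p) \<lhd>\<^bsub>L\<^esub> lam (base_ob (msrc p)),
      mtrg = restrict_psalg T L R V lam (mtrg p)\<rparr>"

definition restrict_ps ::
  "('o, 'm, 'c) monad_data \<Rightarrow> ('p, 'n, 'd) two_cat \<Rightarrow> ('p, 'n, 'd) monad_data
    \<Rightarrow> ('o, 'm, 'c, 'p, 'n, 'd) two_map \<Rightarrow> ('o \<Rightarrow> 'n)
    \<Rightarrow> (('o, 'm, 'c) psalg, ('o, 'm, 'c) psmor, ('o, 'm, 'c) algtrans,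
        ('p, 'n, 'd) psalg, ('p, 'n, 'd) psmor, ('p, 'n, 'd) algtrans) two_map" where
  "restrict_ps T L R V lam =
     \<lparr>on0 = restrict_psalg T L R V lam,
      on1 = restrict_psmor T L R V lam,
      on2 = (\<lambda>t. \<lparr>tsrc = restrict_psmor T L R V lam (tsrc t),
                  tcell = on2 V (tcell t),
                  ttrg = restrict_psmor T L R V lam (ttrg t)\<rparr>)\<rparr>"

end

theory Submission
  imports Defs
begin

text \<open>
  Put \<open>\<Lambda>\<^sub>X = \<lambda>\<^bsub>TX\<^esub> R\<lambda>\<^sub>X\<close> and \<open>\<Lambda>\<^sub>X\<^sup>3 = \<lambda>\<^bsub>TTX\<^esub> R\<Lambda>\<^sub>X\<close>. Naturality of \<open>\<lambda>\<close> and the two colax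
  axioms move every unit or multiplication of \<open>R\<close> through these 1-cells to the corresponding cell of
  \<open>T\<close>; for instance \<open>\<Lambda>\<^sub>X R\<eta> = VT\<eta> \<lambda>\<^sub>X\<close> and \<open>\<Lambda>\<^sub>X R\<mu> = VT\<mu> \<Lambda>\<^sub>X\<^sup>3\<close>. Hence both sides of each pseudoalgebra,
  pseudomorphism or transformation axiom over \<open>R\<close> are the \<open>V\<close>-images of the sides of the same axiom
  over \<open>T\<close>, whiskered on the right with \<open>\<lambda>\<^sub>X\<close>, \<open>\<Lambda>\<^sub>X\<close>, \<open>\<Lambda>\<^sub>X\<^sup>3\<close> or an identity.
\<close>

section \<open>Boundaries and whiskering\<close>

text \<open>
  The axioms of \<^locale>\<open>two_category\<close> are restated with equational boundary conditions in place of
  hom-set membership, so that the simplifier can discharge them. Its normal forms are right-nested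
  vertical composites of whiskered cells \<open>id2 C g \<star> \<alpha> \<star> id2 C f\<close>.
\<close>

context two_category
begin

lemma id1_cell [simp]:
  assumes "X \<in> obj C"
  shows "id1 C X \<in> cell1 C" "dom1 C (id1 C X) = X" "cod1 C (id1 C X) = X"
  using id1_hom[OF assms] by (simp_all add: hom1_def)

lemma comp1_cell [simp]:
  assumes "f \<in> cell1 C" "g \<in> cell1 C" "cod1 C f = dom1 C g"
  shows "g \<odot> f \<in> cell1 C" "dom1 C (g \<odot> f) = dom1 C f" "cod1 C (g \<odot> f) = cod1 C g"
  using comp1_hom[of f "dom1 C f" "cod1 C f" g "cod1 C g"] assms by (simp_all add: hom1_def)

lemma comp1_normal [simp]:
  "f \<in> cell1 C \<Longrightarrow> cod1 C f = Y \<Longrightarrow> id1 C Y \<odot> f = f"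
  "f \<in> cell1 C \<Longrightarrow> dom1 C f = X \<Longrightarrow> f \<odot> id1 C X = f"
  "f \<in> cell1 C \<Longrightarrow> g \<in> cell1 C \<Longrightarrow> h \<in> cell1 C \<Longrightarrow> cod1 C f = dom1 C g \<Longrightarrow> cod1 C g = dom1 C h
    \<Longrightarrow> (h \<odot> g) \<odot> f = h \<odot> g \<odot> f"
  using comp1_id_left[of f "dom1 C f" Y] comp1_id_right[of f X "cod1 C f"]
    comp1_assoc[of f "dom1 C f" "cod1 C f" g "cod1 C g" h "cod1 C h"]
  by (simp_all add: hom1_def)

text \<open>With composites nested to the right, an equation between two-factor composites can match
  only at the end of a longer one. This form adds the tail \<open>e\<close>; applying
  \<open>dom1\<close> to the equation gives the missing agreement of domains.\<close>

lemma comp1_eq_assoc: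
  assumes "g \<odot> f = k \<odot> h" "f \<in> cell1 C" "g \<in> cell1 C" "cod1 C f = dom1 C g"
    "h \<in> cell1 C" "k \<in> cell1 C" "cod1 C h = dom1 C k" "e \<in> cell1 C" "cod1 C e = dom1 C f"
  shows "g \<odot> f \<odot> e = k \<odot> h \<odot> e"
proof -
  have "dom1 C h = dom1 C f"
    using assms(2-7) arg_cong[OF assms(1), of "dom1 C"] by simp
  then show ?thesis
    using comp1_normal(3)[of e f g] comp1_normal(3)[of e h k] assms by simp
qed

lemma cell2_boundary [simp]:
  "\<alpha> \<in> cell2 C \<Longrightarrow> dom2 C \<alpha> \<in> cell1 C"
  "\<alpha> \<in> cell2 C \<Longrightarrow> cod2 C \<alpha> \<in> cell1 C"
  "\<alpha> \<in> cell2 C \<Longrightarrow> dom1 C (cod2 C \<alpha>) = dom1 C (dom2 C \<alpha>)"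
  "\<alpha> \<in> cell2 C \<Longrightarrow> cod1 C (cod2 C \<alpha>) = cod1 C (dom2 C \<alpha>)"
  by (simp_all add: dom2_cell1 cod2_cell1 globular_dom globular_cod)

declare dom1_obj [simp] cod1_obj [simp]

lemma id2_cell [simp]:
  assumes "f \<in> cell1 C"
  shows "id2 C f \<in> cell2 C" "dom2 C (id2 C f) = f" "cod2 C (id2 C f) = f"
  using id2_hom[OF assms] by (simp_all add: hom2_def)

lemma vcomp_cell [simp]:
  assumes "\<alpha> \<in> cell2 C" "\<beta> \<in> cell2 C" "cod2 C \<alpha> = dom2 C \<beta>"
  shows "\<beta> \<cdot> \<alpha> \<in> cell2 C" "dom2 C (\<beta> \<cdot> \<alpha>) = dom2 C \<alpha>" "cod2 C (\<beta> \<cdot> \<alpha>) = cod2 C \<beta>"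
  using vcomp_hom[of \<alpha> "dom2 C \<alpha>" "cod2 C \<alpha>" \<beta> "cod2 C \<beta>"] assms by (simp_all add: hom2_def)

lemma vcomp_normal [simp]:
  "\<alpha> \<in> cell2 C \<Longrightarrow> cod2 C \<alpha> = g \<Longrightarrow> id2 C g \<cdot> \<alpha> = \<alpha>"
  "\<alpha> \<in> cell2 C \<Longrightarrow> dom2 C \<alpha> = f \<Longrightarrow> \<alpha> \<cdot> id2 C f = \<alpha>"
  "\<alpha> \<in> cell2 C \<Longrightarrow> \<beta> \<in> cell2 C \<Longrightarrow> \<gamma> \<in> cell2 C \<Longrightarrow> cod2 C \<alpha> = dom2 C \<beta> \<Longrightarrow> cod2 C \<beta> = dom2 C \<gamma>
    \<Longrightarrow> (\<gamma> \<cdot> \<beta>) \<cdot> \<alpha> = \<gamma> \<cdot> \<beta> \<cdot> \<alpha>"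
  using vcomp_id_left[of \<alpha> "dom2 C \<alpha>" g] vcomp_id_right[of \<alpha> f "cod2 C \<alpha>"]
    vcomp_assoc[of \<alpha> "dom2 C \<alpha>" "cod2 C \<alpha>" \<beta> "cod2 C \<beta>" \<gamma> "cod2 C \<gamma>"]
  by (simp_all add: hom2_def)

lemma hcomp_cell [simp]:
  assumes "\<alpha> \<in> cell2 C" "\<beta> \<in> cell2 C" "cod1 C (dom2 C \<alpha>) = dom1 C (dom2 C \<beta>)"
  shows "\<beta> \<star> \<alpha> \<in> cell2 C" "dom2 C (\<beta> \<star> \<alpha>) = dom2 C \<beta> \<odot> dom2 C \<alpha>"
    "cod2 C (\<beta> \<star> \<alpha>) = cod2 C \<beta> \<odot> cod2 C \<alpha>"
  using hcomp_hom[of "dom2 C \<alpha>" "dom1 C (dom2 C \<alpha>)" "cod1 C (dom2 C \<alpha>)" "dom2 C \<beta>"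
      "cod1 C (dom2 C \<beta>)" \<alpha> "cod2 C \<alpha>" \<beta> "cod2 C \<beta>"] assms
  by (simp_all add: hom1_def hom2_def)

lemma hcomp_normal [simp]:
  "\<alpha> \<in> cell2 C \<Longrightarrow> cod1 C (dom2 C \<alpha>) = Y \<Longrightarrow> id2 C (id1 C Y) \<star> \<alpha> = \<alpha>"
  "\<alpha> \<in> cell2 C \<Longrightarrow> dom1 C (dom2 C \<alpha>) = X \<Longrightarrow> \<alpha> \<star> id2 C (id1 C X) = \<alpha>"
  "f \<in> cell1 C \<Longrightarrow> g \<in> cell1 C \<Longrightarrow> cod1 C f = dom1 C g \<Longrightarrow> id2 C g \<star> id2 C f = id2 C (g \<odot> f)"
  using hcomp_id_left[of "dom2 C \<alpha>" "dom1 C (dom2 C \<alpha>)" Y \<alpha> "cod2 C \<alpha>"]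
    hcomp_id_right[of "dom2 C \<alpha>" X "cod1 C (dom2 C \<alpha>)" \<alpha> "cod2 C \<alpha>"]
    hcomp_id2[of f "dom1 C f" "cod1 C f" g "cod1 C g"]
  by (simp_all add: hom1_def hom2_def)

lemma hcomp_assoc_normal [simp]:
  "\<alpha> \<in> cell2 C \<Longrightarrow> \<beta> \<in> cell2 C \<Longrightarrow> \<gamma> \<in> cell2 C \<Longrightarrow> cod1 C (dom2 C \<alpha>) = dom1 C (dom2 C \<beta>)
    \<Longrightarrow> cod1 C (dom2 C \<beta>) = dom1 C (dom2 C \<gamma>) \<Longrightarrow> (\<gamma> \<star> \<beta>) \<star> \<alpha> = \<gamma> \<star> \<beta> \<star> \<alpha>"
  using hcomp_assoc[of "dom2 C \<alpha>" "dom1 C (dom2 C \<alpha>)" "dom1 C (dom2 C \<beta>)" "dom2 C \<beta>"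
      "dom1 C (dom2 C \<gamma>)" "dom2 C \<gamma>" "cod1 C (dom2 C \<gamma>)" \<alpha> "cod2 C \<alpha>" \<beta> "cod2 C \<beta>" \<gamma> "cod2 C \<gamma>"]
  by (simp add: hom1_def hom2_def)

text \<open>Identity factors on the left are collected into a single one, against the general
  direction of reassociation. Hence \<open>hcomp_assoc_normal\<close> is removed in the proof, where
  the left-nested form lets the two identities merge.\<close>

lemma whisker_left_left [simp]:
  assumes "f \<in> cell1 C" "g \<in> cell1 C" "cod1 C f = dom1 C g"
    "\<alpha> \<in> cell2 C" "cod1 C (dom2 C \<alpha>) = dom1 C f"
  shows "id2 C g \<star> id2 C f \<star> \<alpha> = id2 C (g \<odot> f) \<star> \<alpha>"
  using hcomp_assoc_normal[of \<alpha> "id2 C f" "id2 C g"] assms by (simp del: hcomp_assoc_normal)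

text \<open>The full law stays out of the simplifier; only its two whiskering instances below serve
  as rewrite rules.\<close>

lemma interchange_cell:
  assumes "\<alpha> \<in> cell2 C" "\<beta> \<in> cell2 C" "cod2 C \<alpha> = dom2 C \<beta>"
    "\<gamma> \<in> cell2 C" "\<delta> \<in> cell2 C" "cod2 C \<gamma> = dom2 C \<delta>" "cod1 C (dom2 C \<alpha>) = dom1 C (dom2 C \<gamma>)"
  shows "(\<delta> \<cdot> \<gamma>) \<star> (\<beta> \<cdot> \<alpha>) = (\<delta> \<star> \<beta>) \<cdot> (\<gamma> \<star> \<alpha>)"
  using assms by (intro interchange[of "dom2 C \<alpha>" "dom1 C (dom2 C \<alpha>)" "dom1 C (dom2 C \<gamma>)" "dom2 C \<gamma>"
      "cod1 C (dom2 C \<gamma>)" _ "cod2 C \<alpha>" _ "cod2 C \<beta>" _ "cod2 C \<gamma>" _ "cod2 C \<delta>"])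
    (simp_all add: hom1_def hom2_def)

lemma whisker_left_vcomp [simp]:
  assumes "\<alpha> \<in> cell2 C" "\<beta> \<in> cell2 C" "cod2 C \<alpha> = dom2 C \<beta>" "g \<in> cell1 C"
    "cod1 C (dom2 C \<alpha>) = dom1 C g"
  shows "id2 C g \<star> (\<beta> \<cdot> \<alpha>) = (id2 C g \<star> \<beta>) \<cdot> (id2 C g \<star> \<alpha>)"
  using interchange_cell[of \<alpha> \<beta> "id2 C g" "id2 C g"] assms by simp

lemma whisker_right_vcomp [simp]:
  assumes "\<alpha> \<in> cell2 C" "\<beta> \<in> cell2 C" "cod2 C \<alpha> = dom2 C \<beta>" "f \<in> cell1 C"
    "cod1 C f = dom1 C (dom2 C \<alpha>)"
  shows "(\<beta> \<cdot> \<alpha>) \<star> id2 C f = (\<beta> \<star> id2 C f) \<cdot> (\<alpha> \<star> id2 C f)"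
  using interchange_cell[of "id2 C f" "id2 C f" \<alpha> \<beta>] assms by simp

text \<open>Interchange, after padding \<beta> with the identity on its target and \<alpha> with the
  identity on its source. Comparing this with the opposite order below lets two cells slide past
  each other.\<close>

lemma hcomp_eq_left_after_right:
  assumes "\<alpha> \<in> cell2 C" "\<beta> \<in> cell2 C" "cod1 C (dom2 C \<alpha>) = dom1 C (dom2 C \<beta>)"
  shows "\<beta> \<star> \<alpha> = (id2 C (cod2 C \<beta>) \<star> \<alpha>) \<cdot> (\<beta> \<star> id2 C (dom2 C \<alpha>))"
  using interchange_cell[of "id2 C (dom2 C \<alpha>)" \<alpha> \<beta> "id2 C (cod2 C \<beta>)"] assms by simp

lemma hcomp_eq_right_after_left:
  assumes "\<alpha> \<in> cell2 C" "\<beta> \<in> cell2 C" "cod1 C (dom2 C \<alpha>) = dom1 C (dom2 C \<beta>)"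
  shows "\<beta> \<star> \<alpha> = (\<beta> \<star> id2 C (cod2 C \<alpha>)) \<cdot> (id2 C (dom2 C \<beta>) \<star> \<alpha>)"
  using interchange_cell[of \<alpha> "id2 C (cod2 C \<alpha>)" "id2 C (dom2 C \<beta>)" \<beta>] assms by simp

section \<open>Invertible 2-cells and their composites\<close>

lemma invertible2I:
  assumes "\<alpha> \<in> cell2 C" "\<beta> \<in> cell2 C" "dom2 C \<beta> = cod2 C \<alpha>" "cod2 C \<beta> = dom2 C \<alpha>"
    "\<beta> \<cdot> \<alpha> = id2 C (dom2 C \<alpha>)" "\<alpha> \<cdot> \<beta> = id2 C (cod2 C \<alpha>)"
  shows "invertible2 C \<alpha>"
  using assms by (auto simp: invertible2_def hom2_def)

lemma invertible2_id2: "f \<in> cell1 C \<Longrightarrow> invertible2 C (id2 C f)"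
  by (rule invertible2I[of _ "id2 C f"]) simp_all

lemma invertible2_vcomp:
  assumes "invertible2 C \<alpha>" "invertible2 C \<beta>" "cod2 C \<alpha> = dom2 C \<beta>"
  shows "invertible2 C (\<beta> \<cdot> \<alpha>)"
proof -
  from assms obtain \<alpha>' \<beta>' where inv:
    "\<alpha>' \<in> cell2 C" "dom2 C \<alpha>' = cod2 C \<alpha>" "cod2 C \<alpha>' = dom2 C \<alpha>"
    "\<alpha>' \<cdot> \<alpha> = id2 C (dom2 C \<alpha>)" "\<alpha> \<cdot> \<alpha>' = id2 C (cod2 C \<alpha>)"
    "\<beta>' \<in> cell2 C" "dom2 C \<beta>' = cod2 C \<beta>" "cod2 C \<beta>' = dom2 C \<beta>"
    "\<beta>' \<cdot> \<beta> = id2 C (dom2 C \<beta>)" "\<beta> \<cdot> \<beta>' = id2 C (cod2 C \<beta>)"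
    and cells: "\<alpha> \<in> cell2 C" "\<beta> \<in> cell2 C"
    by (auto simp: invertible2_def hom2_def)
  \<comment> \<open>Right nesting separates each cell from its inverse. The composites are therefore
    regrouped from boundary facts alone, so that the middle pair cancels first.\<close>
  have "(\<alpha>' \<cdot> \<beta>') \<cdot> (\<beta> \<cdot> \<alpha>) = \<alpha>' \<cdot> (\<beta>' \<cdot> \<beta>) \<cdot> \<alpha>"
    "(\<beta> \<cdot> \<alpha>) \<cdot> (\<alpha>' \<cdot> \<beta>') = \<beta> \<cdot> (\<alpha> \<cdot> \<alpha>') \<cdot> \<beta>'"
    using inv(1-3,6-8) cells assms(3) by simp_all
  then show ?thesis
    using inv cells assms(3) by (intro invertible2I[of _ "\<alpha>' \<cdot> \<beta>'"]) simp_all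
qed

text \<open>The inverse is the horizontal composite of the inverses; interchange, read from right to
  left, cancels both factors at once.\<close>

lemma invertible2_hcomp:
  assumes "invertible2 C \<alpha>" "invertible2 C \<beta>" "cod1 C (dom2 C \<alpha>) = dom1 C (dom2 C \<beta>)"
  shows "invertible2 C (\<beta> \<star> \<alpha>)"
proof -
  from assms obtain \<alpha>' \<beta>' where inv:
    "\<alpha>' \<in> cell2 C" "dom2 C \<alpha>' = cod2 C \<alpha>" "cod2 C \<alpha>' = dom2 C \<alpha>"
    "\<alpha>' \<cdot> \<alpha> = id2 C (dom2 C \<alpha>)" "\<alpha> \<cdot> \<alpha>' = id2 C (cod2 C \<alpha>)"
    "\<beta>' \<in> cell2 C" "dom2 C \<beta>' = cod2 C \<beta>" "cod2 C \<beta>' = dom2 C \<beta>"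
    "\<beta>' \<cdot> \<beta> = id2 C (dom2 C \<beta>)" "\<beta> \<cdot> \<beta>' = id2 C (cod2 C \<beta>)"
    and cells: "\<alpha> \<in> cell2 C" "\<beta> \<in> cell2 C"
    by (auto simp: invertible2_def hom2_def)
  have "(\<beta>' \<star> \<alpha>') \<cdot> (\<beta> \<star> \<alpha>) = id2 C (dom2 C \<beta> \<odot> dom2 C \<alpha>)"
    "(\<beta> \<star> \<alpha>) \<cdot> (\<beta>' \<star> \<alpha>') = id2 C (cod2 C \<beta> \<odot> cod2 C \<alpha>)"
    using inv cells assms(3) by (simp_all flip: interchange_cell)
  then show ?thesis
    using inv cells assms(3) by (intro invertible2I[of _ "\<beta>' \<star> \<alpha>'"]) simp_all
qed

end

lemma id_map_simps [simp]: "on0 id_map X = X" "on1 id_map f = f" "on2 id_map \<alpha> = \<alpha>"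
  by (simp_all add: id_map_def)

lemma comp_map_simps [simp]:
  "on0 (comp_map G F) X = on0 G (on0 F X)"
  "on1 (comp_map G F) f = on1 G (on1 F f)"
  "on2 (comp_map G F) \<alpha> = on2 G (on2 F \<alpha>)"
  by (simp_all add: comp_map_def)

section \<open>Strict 2-functors in terms of boundaries\<close>

context two_functor
begin

declare on0_obj [simp] on1_id [simp] on2_id [simp]

lemma on1_cell [simp]:
  assumes "f \<in> cell1 C"
  shows "on1 F f \<in> cell1 D" "dom1 D (on1 F f) = on0 F (dom1 C f)" "cod1 D (on1 F f) = on0 F (cod1 C f)"
  using on1_hom[of f "dom1 C f" "cod1 C f"] assms by (simp_all add: hom1_def)

lemma on2_cell [simp]:
  assumes "\<alpha> \<in> cell2 C"
  shows "on2 F \<alpha> \<in> cell2 D" "dom2 D (on2 F \<alpha>) = on1 F (dom2 C \<alpha>)" "cod2 D (on2 F \<alpha>) = on1 F (cod2 C \<alpha>)"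
  using on2_hom[of \<alpha> "dom2 C \<alpha>" "cod2 C \<alpha>"] assms by (simp_all add: hom2_def)

lemma on1_comp_cell [simp]:
  "f \<in> cell1 C \<Longrightarrow> g \<in> cell1 C \<Longrightarrow> cod1 C f = dom1 C g
    \<Longrightarrow> on1 F (g \<odot>\<^bsub>C\<^esub> f) = on1 F g \<odot>\<^bsub>D\<^esub> on1 F f"
  using on1_comp[of f "dom1 C f" "cod1 C f" g "cod1 C g"] by (simp add: hom1_def)

lemma on2_vcomp_cell [simp]:
  "\<alpha> \<in> cell2 C \<Longrightarrow> \<beta> \<in> cell2 C \<Longrightarrow> cod2 C \<alpha> = dom2 C \<beta>
    \<Longrightarrow> on2 F (\<beta> \<cdot>\<^bsub>C\<^esub> \<alpha>) = on2 F \<beta> \<cdot>\<^bsub>D\<^esub> on2 F \<alpha>"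
  using on2_vcomp[of \<alpha> "dom2 C \<alpha>" "cod2 C \<alpha>" \<beta> "cod2 C \<beta>"] by (simp add: hom2_def)

lemma on2_hcomp_cell [simp]:
  "\<alpha> \<in> cell2 C \<Longrightarrow> \<beta> \<in> cell2 C \<Longrightarrow> cod1 C (dom2 C \<alpha>) = dom1 C (dom2 C \<beta>)
    \<Longrightarrow> on2 F (\<beta> \<star>\<^bsub>C\<^esub> \<alpha>) = on2 F \<beta> \<star>\<^bsub>D\<^esub> on2 F \<alpha>"
  using on2_hcomp[of "dom2 C \<alpha>" "dom1 C (dom2 C \<alpha>)" "cod1 C (dom2 C \<alpha>)" "dom2 C \<beta>"
      "cod1 C (dom2 C \<beta>)" \<alpha> "cod2 C \<alpha>" \<beta> "cod2 C \<beta>"]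
  by (simp add: hom1_def hom2_def)

lemma invertible2_on2:
  assumes "invertible2 C \<alpha>"
  shows "invertible2 D (on2 F \<alpha>)"
proof -
  from assms obtain \<beta> where inv:
    "\<alpha> \<in> cell2 C" "\<beta> \<in> cell2 C" "dom2 C \<beta> = cod2 C \<alpha>" "cod2 C \<beta> = dom2 C \<alpha>"
    "\<beta> \<cdot>\<^bsub>C\<^esub> \<alpha> = id2 C (dom2 C \<alpha>)" "\<alpha> \<cdot>\<^bsub>C\<^esub> \<beta> = id2 C (cod2 C \<alpha>)"
    by (auto simp: invertible2_def hom2_def)
  then have "on2 F \<beta> \<cdot>\<^bsub>D\<^esub> on2 F \<alpha> = id2 D (on1 F (dom2 C \<alpha>))"
    "on2 F \<alpha> \<cdot>\<^bsub>D\<^esub> on2 F \<beta> = id2 D (on1 F (cod2 C \<alpha>))"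
    by (simp_all flip: on2_vcomp_cell)
  then show ?thesis
    using inv by (intro D.invertible2I[of _ "on2 F \<beta>"]) simp_all
qed

end

section \<open>2-natural transformations in terms of boundaries\<close>

context two_natural
begin

lemma component_cell [simp]:
  assumes "X \<in> obj C"
  shows "\<tau> X \<in> cell1 D" "dom1 D (\<tau> X) = on0 F X" "cod1 D (\<tau> X) = on0 G X"
  using component_hom[OF assms] by (simp_all add: hom1_def)

lemma natural1_cell:
  "f \<in> cell1 C \<Longrightarrow> on1 G f \<odot>\<^bsub>D\<^esub> \<tau> (dom1 C f) = \<tau> (cod1 C f) \<odot>\<^bsub>D\<^esub> on1 F f"
  using natural1[of f] by (simp add: hom1_def)

lemma natural2_cell:
  "\<alpha> \<in> cell2 C \<Longrightarrow>
    on2 G \<alpha> \<lhd>\<^bsub>D\<^esub> \<tau> (dom1 C (dom2 C \<alpha>)) = \<tau> (cod1 C (dom2 C \<alpha>)) \<rhd>\<^bsub>D\<^esub> on2 F \<alpha>"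
  using natural2[of "dom2 C \<alpha>" _ _ \<alpha> "cod2 C \<alpha>"] by (simp add: hom1_def hom2_def)

end

section \<open>The 2-category of pseudoalgebras\<close>

lemma PsAlg_simps [simp]:
  "A \<in> obj (PsAlg K T) \<longleftrightarrow> is_psalg K T A"
  "p \<in> cell1 (PsAlg K T) \<longleftrightarrow> is_psmor K T p"
  "t \<in> cell2 (PsAlg K T) \<longleftrightarrow> is_algtrans K T t"
  "dom1 (PsAlg K T) = msrc" "cod1 (PsAlg K T) = mtrg"
  "dom2 (PsAlg K T) = tsrc" "cod2 (PsAlg K T) = ttrg"
  "id1 (PsAlg K T) = id_psmor K" "comp1 (PsAlg K T) = comp_psmor K T"
  "id2 (PsAlg K T) p = \<lparr>tsrc = p, tcell = id2 K (mmap p), ttrg = p\<rparr>"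
  "vcomp (PsAlg K T) t s = \<lparr>tsrc = tsrc s, tcell = tcell t \<cdot>\<^bsub>K\<^esub> tcell s, ttrg = ttrg t\<rparr>"
  "hcomp (PsAlg K T) t s = \<lparr>tsrc = comp_psmor K T (tsrc t) (tsrc s),
     tcell = tcell t \<star>\<^bsub>K\<^esub> tcell s, ttrg = comp_psmor K T (ttrg t) (ttrg s)\<rparr>"
  by (simp_all add: PsAlg_def)

lemma psmor_simps [simp]:
  "msrc (id_psmor K A) = A" "mtrg (id_psmor K A) = A"
  "mmap (id_psmor K A) = id1 K (base_ob A)" "mcell (id_psmor K A) = id2 K (act A)"
  "msrc (comp_psmor K T q p) = msrc p" "mtrg (comp_psmor K T q p) = mtrg q"
  "mmap (comp_psmor K T q p) = mmap q \<odot>\<^bsub>K\<^esub> mmap p"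
  "mcell (comp_psmor K T q p)
    = (mmap q \<rhd>\<^bsub>K\<^esub> mcell p) \<cdot>\<^bsub>K\<^esub> (mcell q \<lhd>\<^bsub>K\<^esub> on1 (endo T) (mmap p))"
  by (simp_all add: id_psmor_def comp_psmor_def)

section \<open>Boundaries and coherence laws of algebraic data over a 2-monad\<close>

context two_monad
begin

lemma psalg_cells [simp]:
  assumes "is_psalg K T A"
  shows "base_ob A \<in> obj K"
    "act A \<in> cell1 K" "dom1 K (act A) = on0 (endo T) (base_ob A)" "cod1 K (act A) = base_ob A"
    "unit_cell A \<in> cell2 K" "dom2 K (unit_cell A) = id1 K (base_ob A)"
    "cod2 K (unit_cell A) = act A \<odot>\<^bsub>K\<^esub> eta T (base_ob A)"
    "mult_cell A \<in> cell2 K" "dom2 K (mult_cell A) = act A \<odot>\<^bsub>K\<^esub> on1 (endo T) (act A)"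
    "cod2 K (mult_cell A) = act A \<odot>\<^bsub>K\<^esub> mu T (base_ob A)"
  using assms unfolding is_psalg_def Let_def hom1_def hom2_def mem_Collect_eq by blast+

lemma psalg_invertible:
  assumes "is_psalg K T A"
  shows "invertible2 K (unit_cell A)" "invertible2 K (mult_cell A)"
  using assms unfolding is_psalg_def Let_def by blast+

text \<open>Unlike the boundary facts, the coherence equations are not rewrite rules: they are
  applied at chosen places, after the relevant pair of cells has been grouped.\<close>

lemma psalg_laws:
  assumes "is_psalg K T A"
  shows "(mult_cell A \<lhd>\<^bsub>K\<^esub> on1 (endo T) (eta T (base_ob A)))
      \<cdot>\<^bsub>K\<^esub> (act A \<rhd>\<^bsub>K\<^esub> on2 (endo T) (unit_cell A)) = id2 K (act A)"
    "(mult_cell A \<lhd>\<^bsub>K\<^esub> eta T (on0 (endo T) (base_ob A))) \<cdot>\<^bsub>K\<^esub> (unit_cell A \<lhd>\<^bsub>K\<^esub> act A)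
      = id2 K (act A)"
    "(mult_cell A \<lhd>\<^bsub>K\<^esub> on1 (endo T) (mu T (base_ob A)))
      \<cdot>\<^bsub>K\<^esub> (act A \<rhd>\<^bsub>K\<^esub> on2 (endo T) (mult_cell A))
      = (mult_cell A \<lhd>\<^bsub>K\<^esub> mu T (on0 (endo T) (base_ob A)))
        \<cdot>\<^bsub>K\<^esub> (mult_cell A \<lhd>\<^bsub>K\<^esub> on1 (endo T) (on1 (endo T) (act A)))"
  using assms unfolding is_psalg_def Let_def by blast+

lemma psmor_cells [simp]:
  assumes "is_psmor K T p"
  shows "is_psalg K T (msrc p)" "is_psalg K T (mtrg p)"
    "mmap p \<in> cell1 K" "dom1 K (mmap p) = base_ob (msrc p)" "cod1 K (mmap p) = base_ob (mtrg p)"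
    "mcell p \<in> cell2 K" "dom2 K (mcell p) = act (mtrg p) \<odot>\<^bsub>K\<^esub> on1 (endo T) (mmap p)"
    "cod2 K (mcell p) = mmap p \<odot>\<^bsub>K\<^esub> act (msrc p)"
  using assms unfolding is_psmor_def Let_def hom1_def hom2_def mem_Collect_eq by blast+

lemma psmor_invertible: "is_psmor K T p \<Longrightarrow> invertible2 K (mcell p)"
  unfolding is_psmor_def Let_def by blast

lemma psmor_laws:
  assumes "is_psmor K T p"
  shows "(mcell p \<lhd>\<^bsub>K\<^esub> eta T (base_ob (msrc p))) \<cdot>\<^bsub>K\<^esub> (unit_cell (mtrg p) \<lhd>\<^bsub>K\<^esub> mmap p)
      = mmap p \<rhd>\<^bsub>K\<^esub> unit_cell (msrc p)"
    "(mcell p \<lhd>\<^bsub>K\<^esub> mu T (base_ob (msrc p)))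
        \<cdot>\<^bsub>K\<^esub> (mult_cell (mtrg p) \<lhd>\<^bsub>K\<^esub> on1 (endo T) (on1 (endo T) (mmap p)))
      = (mmap p \<rhd>\<^bsub>K\<^esub> mult_cell (msrc p)) \<cdot>\<^bsub>K\<^esub> (mcell p \<lhd>\<^bsub>K\<^esub> on1 (endo T) (act (msrc p)))
        \<cdot>\<^bsub>K\<^esub> (act (mtrg p) \<rhd>\<^bsub>K\<^esub> on2 (endo T) (mcell p))"
  using assms unfolding is_psmor_def Let_def by blast+

lemma algtrans_cells [simp]:
  assumes "is_algtrans K T t"
  shows "is_psmor K T (tsrc t)" "is_psmor K T (ttrg t)"
    "msrc (ttrg t) = msrc (tsrc t)" "mtrg (ttrg t) = mtrg (tsrc t)"
    "tcell t \<in> cell2 K" "dom2 K (tcell t) = mmap (tsrc t)" "cod2 K (tcell t) = mmap (ttrg t)"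
  using assms unfolding is_algtrans_def Let_def hom2_def mem_Collect_eq by metis+

lemma algtrans_law:
  "is_algtrans K T t \<Longrightarrow> (tcell t \<lhd>\<^bsub>K\<^esub> act (msrc (tsrc t))) \<cdot>\<^bsub>K\<^esub> mcell (tsrc t)
    = mcell (ttrg t) \<cdot>\<^bsub>K\<^esub> (act (mtrg (tsrc t)) \<rhd>\<^bsub>K\<^esub> on2 (endo T) (tcell t))"
  unfolding is_algtrans_def Let_def by blast

lemma is_psalgI:
  assumes "base_ob A \<in> obj K"
    "act A \<in> hom1 K (on0 (endo T) (base_ob A)) (base_ob A)"
    "unit_cell A \<in> hom2 K (id1 K (base_ob A)) (act A \<odot>\<^bsub>K\<^esub> eta T (base_ob A))"
    "invertible2 K (unit_cell A)"
    "mult_cell A \<in> hom2 K (act A \<odot>\<^bsub>K\<^esub> on1 (endo T) (act A)) (act A \<odot>\<^bsub>K\<^esub> mu T (base_ob A))"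
    "invertible2 K (mult_cell A)"
    "(mult_cell A \<lhd>\<^bsub>K\<^esub> on1 (endo T) (eta T (base_ob A)))
      \<cdot>\<^bsub>K\<^esub> (act A \<rhd>\<^bsub>K\<^esub> on2 (endo T) (unit_cell A)) = id2 K (act A)"
    "(mult_cell A \<lhd>\<^bsub>K\<^esub> eta T (on0 (endo T) (base_ob A))) \<cdot>\<^bsub>K\<^esub> (unit_cell A \<lhd>\<^bsub>K\<^esub> act A)
      = id2 K (act A)"
    "(mult_cell A \<lhd>\<^bsub>K\<^esub> on1 (endo T) (mu T (base_ob A)))
      \<cdot>\<^bsub>K\<^esub> (act A \<rhd>\<^bsub>K\<^esub> on2 (endo T) (mult_cell A))
      = (mult_cell A \<lhd>\<^bsub>K\<^esub> mu T (on0 (endo T) (base_ob A)))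
        \<cdot>\<^bsub>K\<^esub> (mult_cell A \<lhd>\<^bsub>K\<^esub> on1 (endo T) (on1 (endo T) (act A)))"
  shows "is_psalg K T A"
  using assms unfolding is_psalg_def Let_def by blast

lemma is_psmorI:
  assumes "is_psalg K T (msrc p)" "is_psalg K T (mtrg p)"
    "mmap p \<in> hom1 K (base_ob (msrc p)) (base_ob (mtrg p))"
    "mcell p \<in> hom2 K (act (mtrg p) \<odot>\<^bsub>K\<^esub> on1 (endo T) (mmap p)) (mmap p \<odot>\<^bsub>K\<^esub> act (msrc p))"
    "invertible2 K (mcell p)"
    "(mcell p \<lhd>\<^bsub>K\<^esub> eta T (base_ob (msrc p))) \<cdot>\<^bsub>K\<^esub> (unit_cell (mtrg p) \<lhd>\<^bsub>K\<^esub> mmap p)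
      = mmap p \<rhd>\<^bsub>K\<^esub> unit_cell (msrc p)"
    "(mcell p \<lhd>\<^bsub>K\<^esub> mu T (base_ob (msrc p)))
        \<cdot>\<^bsub>K\<^esub> (mult_cell (mtrg p) \<lhd>\<^bsub>K\<^esub> on1 (endo T) (on1 (endo T) (mmap p)))
      = (mmap p \<rhd>\<^bsub>K\<^esub> mult_cell (msrc p)) \<cdot>\<^bsub>K\<^esub> (mcell p \<lhd>\<^bsub>K\<^esub> on1 (endo T) (act (msrc p)))
        \<cdot>\<^bsub>K\<^esub> (act (mtrg p) \<rhd>\<^bsub>K\<^esub> on2 (endo T) (mcell p))"
  shows "is_psmor K T p"
  using assms unfolding is_psmor_def Let_def by blast

lemma is_algtransI:
  assumes "is_psmor K T (tsrc t)" "is_psmor K T (ttrg t)"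
    "msrc (tsrc t) = msrc (ttrg t)" "mtrg (tsrc t) = mtrg (ttrg t)"
    "tcell t \<in> hom2 K (mmap (tsrc t)) (mmap (ttrg t))"
    "(tcell t \<lhd>\<^bsub>K\<^esub> act (msrc (tsrc t))) \<cdot>\<^bsub>K\<^esub> mcell (tsrc t)
      = mcell (ttrg t) \<cdot>\<^bsub>K\<^esub> (act (mtrg (tsrc t)) \<rhd>\<^bsub>K\<^esub> on2 (endo T) (tcell t))"
  shows "is_algtrans K T t"
  using assms unfolding is_algtrans_def Let_def by blast

lemma eta_cell [simp]:
  assumes "X \<in> obj K"
  shows "eta T X \<in> cell1 K" "dom1 K (eta T X) = X" "cod1 K (eta T X) = on0 (endo T) X"
  using unit.component_cell[OF assms] by simp_all

lemma mu_cell [simp]: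
  assumes "X \<in> obj K"
  shows "mu T X \<in> cell1 K" "dom1 K (mu T X) = on0 (endo T) (on0 (endo T) X)"
    "cod1 K (mu T X) = on0 (endo T) X"
  using mult.component_cell[OF assms] by simp_all

text \<open>The orientation moves units to the left. Naming the boundaries \<open>X\<close> and
  \<open>Y\<close> separately lets the rule match already simplified endpoints, and the second form
  serves inside right-nested composites.\<close>

lemma eta_natural:
  assumes "f \<in> cell1 K" "dom1 K f = X" "cod1 K f = Y"
  shows "on1 (endo T) f \<odot>\<^bsub>K\<^esub> eta T X = eta T Y \<odot>\<^bsub>K\<^esub> f"
    "h \<in> cell1 K \<Longrightarrow> cod1 K h = X
      \<Longrightarrow> on1 (endo T) f \<odot>\<^bsub>K\<^esub> eta T X \<odot>\<^bsub>K\<^esub> h = eta T Y \<odot>\<^bsub>K\<^esub> f \<odot>\<^bsub>K\<^esub> h"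
  using unit.natural1_cell[of f] assms by (auto intro: endo.C.comp1_eq_assoc)

lemma mu_natural:
  assumes "f \<in> cell1 K" "dom1 K f = X" "cod1 K f = Y"
  shows "on1 (endo T) f \<odot>\<^bsub>K\<^esub> mu T X = mu T Y \<odot>\<^bsub>K\<^esub> on1 (endo T) (on1 (endo T) f)"
    "h \<in> cell1 K \<Longrightarrow> cod1 K h = on0 (endo T) (on0 (endo T) X)
      \<Longrightarrow> on1 (endo T) f \<odot>\<^bsub>K\<^esub> mu T X \<odot>\<^bsub>K\<^esub> h
        = mu T Y \<odot>\<^bsub>K\<^esub> on1 (endo T) (on1 (endo T) f) \<odot>\<^bsub>K\<^esub> h"
  using mult.natural1_cell[of f] assms by (auto intro: endo.C.comp1_eq_assoc)

section \<open>Identities and composites of pseudomorphisms\<close>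

lemma is_psmor_id:
  assumes "is_psalg K T A"
  shows "is_psmor K T (id_psmor K A)"
  by (rule is_psmorI) (use assms in \<open>simp_all add: hom1_def hom2_def endo.C.invertible2_id2\<close>)

text \<open>Each law follows from that of \<open>q\<close> whiskered on the right, then that of
  \<open>p\<close> whiskered on the left by \<open>g\<close>. The multiplication law also needs one
  interchange of \<psi> with the image of \<phi> under \<open>endo T\<close>.\<close>

lemma is_psmor_comp:
  assumes p: "is_psmor K T p" and q: "is_psmor K T q" and pq: "mtrg p = msrc q"
  shows "is_psmor K T (comp_psmor K T q p)"
proof -
  define X where "X = base_ob (msrc p)"
  define f \<phi> g \<psi> where "f = mmap p" and "\<phi> = mcell p" and "g = mmap q" and "\<psi> = mcell q"
  define a b c where "a = act (msrc p)" and "b = act (msrc q)" and "c = act (mtrg q)"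
  note defs = X_def f_def g_def \<phi>_def \<psi>_def a_def b_def c_def
  let ?T1 = "on1 (endo T)" and ?T2 = "on2 (endo T)"
  have inv: "invertible2 K ((g \<rhd>\<^bsub>K\<^esub> \<phi>) \<cdot>\<^bsub>K\<^esub> (\<psi> \<lhd>\<^bsub>K\<^esub> ?T1 f))"
    using assms unfolding defs
    by (intro endo.C.invertible2_vcomp endo.C.invertible2_hcomp psmor_invertible
        endo.C.invertible2_id2) simp_all
  have unit: "(((g \<rhd>\<^bsub>K\<^esub> \<phi>) \<cdot>\<^bsub>K\<^esub> (\<psi> \<lhd>\<^bsub>K\<^esub> ?T1 f)) \<lhd>\<^bsub>K\<^esub> eta T X)
      \<cdot>\<^bsub>K\<^esub> (unit_cell (mtrg q) \<lhd>\<^bsub>K\<^esub> (g \<odot>\<^bsub>K\<^esub> f)) = (g \<odot>\<^bsub>K\<^esub> f) \<rhd>\<^bsub>K\<^esub> unit_cell (msrc p)" (is "?l = _")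
  proof -
    \<comment> \<open>Naturality of the unit at \<open>f\<close> moves \<open>f\<close> to the far
      right, exposing the unit law of \<open>q\<close> whiskered by \<open>f\<close>.\<close>
    have "?l = ((g \<rhd>\<^bsub>K\<^esub> \<phi>) \<lhd>\<^bsub>K\<^esub> eta T X)
        \<cdot>\<^bsub>K\<^esub> (((\<psi> \<lhd>\<^bsub>K\<^esub> eta T (base_ob (msrc q))) \<cdot>\<^bsub>K\<^esub> (unit_cell (mtrg q) \<lhd>\<^bsub>K\<^esub> g)) \<lhd>\<^bsub>K\<^esub> f)"
      using assms by (simp add: defs eta_natural)
    also have "\<dots> = g \<rhd>\<^bsub>K\<^esub> ((\<phi> \<lhd>\<^bsub>K\<^esub> eta T X) \<cdot>\<^bsub>K\<^esub> (unit_cell (mtrg p) \<lhd>\<^bsub>K\<^esub> f))"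
      using assms psmor_laws(1)[OF q] by (simp add: defs eta_natural)
    also have "\<dots> = (g \<odot>\<^bsub>K\<^esub> f) \<rhd>\<^bsub>K\<^esub> unit_cell (msrc p)"
      using assms psmor_laws(1)[OF p] by (simp add: defs eta_natural)
    finally show ?thesis .
  qed
  have mult: "(((g \<rhd>\<^bsub>K\<^esub> \<phi>) \<cdot>\<^bsub>K\<^esub> (\<psi> \<lhd>\<^bsub>K\<^esub> ?T1 f)) \<lhd>\<^bsub>K\<^esub> mu T X)
      \<cdot>\<^bsub>K\<^esub> (mult_cell (mtrg q) \<lhd>\<^bsub>K\<^esub> ?T1 (?T1 (g \<odot>\<^bsub>K\<^esub> f)))
    = ((g \<odot>\<^bsub>K\<^esub> f) \<rhd>\<^bsub>K\<^esub> mult_cell (msrc p))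
      \<cdot>\<^bsub>K\<^esub> (((g \<rhd>\<^bsub>K\<^esub> \<phi>) \<cdot>\<^bsub>K\<^esub> (\<psi> \<lhd>\<^bsub>K\<^esub> ?T1 f)) \<lhd>\<^bsub>K\<^esub> ?T1 a)
      \<cdot>\<^bsub>K\<^esub> (c \<rhd>\<^bsub>K\<^esub> ?T2 ((g \<rhd>\<^bsub>K\<^esub> \<phi>) \<cdot>\<^bsub>K\<^esub> (\<psi> \<lhd>\<^bsub>K\<^esub> ?T1 f)))" (is "?l = ?r")
  proof -
    \<comment> \<open>Both sides are the horizontal composite of \<psi> with
      \<open>?T2 \<phi>\<close>.\<close>
    have slide: "((g \<odot>\<^bsub>K\<^esub> b) \<rhd>\<^bsub>K\<^esub> ?T2 \<phi>) \<cdot>\<^bsub>K\<^esub> (\<psi> \<lhd>\<^bsub>K\<^esub> (?T1 b \<odot>\<^bsub>K\<^esub> ?T1 (?T1 f)))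
      = (\<psi> \<lhd>\<^bsub>K\<^esub> (?T1 f \<odot>\<^bsub>K\<^esub> ?T1 a)) \<cdot>\<^bsub>K\<^esub> ((c \<odot>\<^bsub>K\<^esub> ?T1 g) \<rhd>\<^bsub>K\<^esub> ?T2 \<phi>)"
      using assms endo.C.hcomp_eq_left_after_right[of "?T2 \<phi>" \<psi>]
        endo.C.hcomp_eq_right_after_left[of "?T2 \<phi>" \<psi>] by (simp add: defs)
    have "?l = ((g \<rhd>\<^bsub>K\<^esub> \<phi>) \<lhd>\<^bsub>K\<^esub> mu T X) \<cdot>\<^bsub>K\<^esub> (((\<psi> \<lhd>\<^bsub>K\<^esub> mu T (base_ob (msrc q)))
        \<cdot>\<^bsub>K\<^esub> (mult_cell (mtrg q) \<lhd>\<^bsub>K\<^esub> ?T1 (?T1 g))) \<lhd>\<^bsub>K\<^esub> ?T1 (?T1 f))"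
      using assms by (simp add: defs mu_natural)
    \<comment> \<open>The law of \<open>q\<close> produces the multiplication cell of the middle
      algebra, which joins \<phi> to form the left side of the law of \<open>p\<close>.\<close>
    also have "\<dots> = (g \<rhd>\<^bsub>K\<^esub> ((\<phi> \<lhd>\<^bsub>K\<^esub> mu T X) \<cdot>\<^bsub>K\<^esub> (mult_cell (mtrg p) \<lhd>\<^bsub>K\<^esub> ?T1 (?T1 f))))
        \<cdot>\<^bsub>K\<^esub> (\<psi> \<lhd>\<^bsub>K\<^esub> (?T1 b \<odot>\<^bsub>K\<^esub> ?T1 (?T1 f))) \<cdot>\<^bsub>K\<^esub> ((c \<rhd>\<^bsub>K\<^esub> ?T2 \<psi>) \<lhd>\<^bsub>K\<^esub> ?T1 (?T1 f))"
      unfolding psmor_laws(2)[OF q, folded defs] using assms by (simp add: defs mu_natural)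
    also have "\<dots> = ((g \<odot>\<^bsub>K\<^esub> f) \<rhd>\<^bsub>K\<^esub> mult_cell (msrc p)) \<cdot>\<^bsub>K\<^esub> ((g \<rhd>\<^bsub>K\<^esub> \<phi>) \<lhd>\<^bsub>K\<^esub> ?T1 a)
        \<cdot>\<^bsub>K\<^esub> (((g \<odot>\<^bsub>K\<^esub> b) \<rhd>\<^bsub>K\<^esub> ?T2 \<phi>) \<cdot>\<^bsub>K\<^esub> (\<psi> \<lhd>\<^bsub>K\<^esub> (?T1 b \<odot>\<^bsub>K\<^esub> ?T1 (?T1 f))))
        \<cdot>\<^bsub>K\<^esub> ((c \<rhd>\<^bsub>K\<^esub> ?T2 \<psi>) \<lhd>\<^bsub>K\<^esub> ?T1 (?T1 f))"
      unfolding psmor_laws(2)[OF p, folded defs] using assms by (simp add: defs mu_natural)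
    also have "\<dots> = ?r"
      unfolding slide using assms by (simp add: defs mu_natural)
    finally show ?thesis .
  qed
  show ?thesis
    by (rule is_psmorI)
      (use assms inv unit mult in \<open>simp_all add: defs hom1_def hom2_def del: endo.C.whisker_right_vcomp\<close>)
qed

section \<open>Identities and composites of algebra transformations\<close>

lemma is_algtrans_id:
  "is_psmor K T p \<Longrightarrow> is_algtrans K T \<lparr>tsrc = p, tcell = id2 K (mmap p), ttrg = p\<rparr>"
  by (rule is_algtransI) (simp_all add: hom2_def)

text \<open>The two compatibility squares are pasted along the shared comparison
  \<open>mcell (tsrc t)\<close>.\<close>

lemma is_algtrans_vcomp:
  assumes s: "is_algtrans K T s" and t: "is_algtrans K T t" and st: "ttrg s = tsrc t"
  shows "is_algtrans K T \<lparr>tsrc = tsrc s, tcell = tcell t \<cdot>\<^bsub>K\<^esub> tcell s, ttrg = ttrg t\<rparr>"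
proof -
  have eq: "msrc (tsrc t) = msrc (tsrc s)" "mtrg (tsrc t) = mtrg (tsrc s)"
    using algtrans_cells(3,4)[OF s] st by simp_all
  let ?a = "act (msrc (tsrc s))" and ?b = "act (mtrg (tsrc s))"
  have "((tcell t \<cdot>\<^bsub>K\<^esub> tcell s) \<lhd>\<^bsub>K\<^esub> ?a) \<cdot>\<^bsub>K\<^esub> mcell (tsrc s)
      = (tcell t \<lhd>\<^bsub>K\<^esub> ?a) \<cdot>\<^bsub>K\<^esub> (tcell s \<lhd>\<^bsub>K\<^esub> ?a) \<cdot>\<^bsub>K\<^esub> mcell (tsrc s)"
    using assms eq by simp
  also have "\<dots> = ((tcell t \<lhd>\<^bsub>K\<^esub> ?a) \<cdot>\<^bsub>K\<^esub> mcell (tsrc t)) \<cdot>\<^bsub>K\<^esub> (?b \<rhd>\<^bsub>K\<^esub> on2 (endo T) (tcell s))"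
    unfolding algtrans_law[OF s] using assms eq by simp
  also have "\<dots> = mcell (ttrg t) \<cdot>\<^bsub>K\<^esub> (?b \<rhd>\<^bsub>K\<^esub> on2 (endo T) (tcell t \<cdot>\<^bsub>K\<^esub> tcell s))"
    using algtrans_law[OF t] assms eq by simp
  finally show ?thesis
    by (intro is_algtransI) (use assms eq in \<open>simp_all add: hom2_def\<close>)
qed

lemma is_algtrans_hcomp:
  assumes s: "is_algtrans K T s" and t: "is_algtrans K T t" and st: "mtrg (tsrc s) = msrc (tsrc t)"
  shows "is_algtrans K T \<lparr>tsrc = comp_psmor K T (tsrc t) (tsrc s), tcell = tcell t \<star>\<^bsub>K\<^esub> tcell s,
    ttrg = comp_psmor K T (ttrg t) (ttrg s)\<rparr>"
proof -
  let ?T1 = "on1 (endo T)" and ?T2 = "on2 (endo T)"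
  define f f' g g' where "f = mmap (tsrc s)" and "f' = mmap (ttrg s)"
    and "g = mmap (tsrc t)" and "g' = mmap (ttrg t)"
  define \<phi> \<phi>' \<psi> \<psi>' where "\<phi> = mcell (tsrc s)" and "\<phi>' = mcell (ttrg s)"
    and "\<psi> = mcell (tsrc t)" and "\<psi>' = mcell (ttrg t)"
  define \<alpha> \<beta> where "\<alpha> = tcell s" and "\<beta> = tcell t"
  define a b c where "a = act (msrc (tsrc s))" and "b = act (mtrg (tsrc s))"
    and "c = act (mtrg (tsrc t))"
  note defs = f_def f'_def g_def g'_def \<phi>_def \<phi>'_def \<psi>_def \<psi>'_def \<alpha>_def \<beta>_def a_def b_def c_def
  have s_law: "(\<alpha> \<lhd>\<^bsub>K\<^esub> a) \<cdot>\<^bsub>K\<^esub> \<phi> = \<phi>' \<cdot>\<^bsub>K\<^esub> (b \<rhd>\<^bsub>K\<^esub> ?T2 \<alpha>)"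
    and t_law: "(\<beta> \<lhd>\<^bsub>K\<^esub> b) \<cdot>\<^bsub>K\<^esub> \<psi> = \<psi>' \<cdot>\<^bsub>K\<^esub> (c \<rhd>\<^bsub>K\<^esub> ?T2 \<beta>)"
    using algtrans_law[OF s] algtrans_law[OF t] st by (simp_all add: defs)
  \<comment> \<open>In this order \<alpha> acts first, so it meets \<phi> directly and the law of
    \<open>s\<close> applies.\<close>
  have h1: "\<beta> \<star>\<^bsub>K\<^esub> \<alpha> = (\<beta> \<lhd>\<^bsub>K\<^esub> f') \<cdot>\<^bsub>K\<^esub> (g \<rhd>\<^bsub>K\<^esub> \<alpha>)"
    using endo.C.hcomp_eq_right_after_left[of \<alpha> \<beta>] assms by (simp add: defs)
  \<comment> \<open>Both sides are the horizontal composite of \<beta> with \<open>\<phi>'\<close>.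
    This brings \<beta> next to \<psi>, where the law of \<open>t\<close> applies.\<close>
  have h2: "(\<beta> \<lhd>\<^bsub>K\<^esub> (f' \<odot>\<^bsub>K\<^esub> a)) \<cdot>\<^bsub>K\<^esub> (g \<rhd>\<^bsub>K\<^esub> \<phi>') = (g' \<rhd>\<^bsub>K\<^esub> \<phi>') \<cdot>\<^bsub>K\<^esub> (\<beta> \<lhd>\<^bsub>K\<^esub> (b \<odot>\<^bsub>K\<^esub> ?T1 f'))"
    using endo.C.hcomp_eq_right_after_left[of \<phi>' \<beta>] endo.C.hcomp_eq_left_after_right[of \<phi>' \<beta>] assms
    by (simp add: defs)
  \<comment> \<open>Both sides are the horizontal composite of \<psi> with
    \<open>?T2 \<alpha>\<close>.\<close>
  have h3: "((g \<odot>\<^bsub>K\<^esub> b) \<rhd>\<^bsub>K\<^esub> ?T2 \<alpha>) \<cdot>\<^bsub>K\<^esub> (\<psi> \<lhd>\<^bsub>K\<^esub> ?T1 f) = (\<psi> \<lhd>\<^bsub>K\<^esub> ?T1 f') \<cdot>\<^bsub>K\<^esub> ((c \<odot>\<^bsub>K\<^esub> ?T1 g) \<rhd>\<^bsub>K\<^esub> ?T2 \<alpha>)"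
    using endo.C.hcomp_eq_right_after_left[of "?T2 \<alpha>" \<psi>]
      endo.C.hcomp_eq_left_after_right[of "?T2 \<alpha>" \<psi>] assms
    by (simp add: defs)
  have "((\<beta> \<star>\<^bsub>K\<^esub> \<alpha>) \<lhd>\<^bsub>K\<^esub> a) \<cdot>\<^bsub>K\<^esub> (g \<rhd>\<^bsub>K\<^esub> \<phi>) \<cdot>\<^bsub>K\<^esub> (\<psi> \<lhd>\<^bsub>K\<^esub> ?T1 f)
      = (\<beta> \<lhd>\<^bsub>K\<^esub> (f' \<odot>\<^bsub>K\<^esub> a)) \<cdot>\<^bsub>K\<^esub> (g \<rhd>\<^bsub>K\<^esub> ((\<alpha> \<lhd>\<^bsub>K\<^esub> a) \<cdot>\<^bsub>K\<^esub> \<phi>)) \<cdot>\<^bsub>K\<^esub> (\<psi> \<lhd>\<^bsub>K\<^esub> ?T1 f)"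
    unfolding h1 using assms by (simp add: defs)
  also have "\<dots> = ((\<beta> \<lhd>\<^bsub>K\<^esub> (f' \<odot>\<^bsub>K\<^esub> a)) \<cdot>\<^bsub>K\<^esub> (g \<rhd>\<^bsub>K\<^esub> \<phi>'))
      \<cdot>\<^bsub>K\<^esub> (((g \<odot>\<^bsub>K\<^esub> b) \<rhd>\<^bsub>K\<^esub> ?T2 \<alpha>) \<cdot>\<^bsub>K\<^esub> (\<psi> \<lhd>\<^bsub>K\<^esub> ?T1 f))"
    unfolding s_law using assms by (simp add: defs)
  also have "\<dots> = (g' \<rhd>\<^bsub>K\<^esub> \<phi>') \<cdot>\<^bsub>K\<^esub> (((\<beta> \<lhd>\<^bsub>K\<^esub> b) \<cdot>\<^bsub>K\<^esub> \<psi>) \<lhd>\<^bsub>K\<^esub> ?T1 f')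
      \<cdot>\<^bsub>K\<^esub> ((c \<odot>\<^bsub>K\<^esub> ?T1 g) \<rhd>\<^bsub>K\<^esub> ?T2 \<alpha>)"
    unfolding h2 h3 using assms by (simp add: defs)
  also have "\<dots> = ((g' \<rhd>\<^bsub>K\<^esub> \<phi>') \<cdot>\<^bsub>K\<^esub> (\<psi>' \<lhd>\<^bsub>K\<^esub> ?T1 f')) \<cdot>\<^bsub>K\<^esub> (c \<rhd>\<^bsub>K\<^esub> ?T2 (\<beta> \<star>\<^bsub>K\<^esub> \<alpha>))"
    unfolding t_law h1 using assms by (simp add: defs)
  finally show ?thesis
    by (intro is_algtransI) (use assms in \<open>simp_all add: hom2_def is_psmor_comp defs\<close>)
qed

text \<open>Closure is supplied by the preceding lemmas. The equations hold on underlying cells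
  because they hold in \<open>K\<close>; for composites of 1-cells, the whiskered comparisons also
  agree by their normal forms.\<close>

lemma two_category_PsAlg: "two_category (PsAlg K T)"
proof unfold_locales
qed (simp_all add: hom1_def hom2_def is_psmor_id is_psmor_comp
  is_algtrans_id is_algtrans_vcomp is_algtrans_hcomp endo.C.interchange_cell)

end

section \<open>Restriction along a colax morphism\<close>

context colax_monad_morphism
begin

section \<open>Naturality of \<lambda>\<close>

lemma lam_cell [simp]:
  assumes "X \<in> obj K"
  shows "lam X \<in> cell1 L" "dom1 L (lam X) = on0 (endo R) (on0 V X)"
    "cod1 L (lam X) = on0 V (on0 (endo T) X)"
  using lam.component_cell[OF assms] by simp_all

text \<open>The orientation pushes \<lambda> to the right, so that what remains on the left is an
  image under \<open>V\<close>.\<close>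

lemma lam_natural1:
  assumes "f \<in> cell1 K" "dom1 K f = X" "cod1 K f = Y"
  shows "lam Y \<odot>\<^bsub>L\<^esub> on1 (endo R) (on1 V f) = on1 V (on1 (endo T) f) \<odot>\<^bsub>L\<^esub> lam X"
    "h \<in> cell1 L \<Longrightarrow> cod1 L h = on0 (endo R) (on0 V X) \<Longrightarrow>
      lam Y \<odot>\<^bsub>L\<^esub> on1 (endo R) (on1 V f) \<odot>\<^bsub>L\<^esub> h = on1 V (on1 (endo T) f) \<odot>\<^bsub>L\<^esub> lam X \<odot>\<^bsub>L\<^esub> h"
  using lam.natural1_cell[of f, symmetric] assms by (auto intro!: R.endo.C.comp1_eq_assoc)

lemma lam_natural2:
  assumes "\<alpha> \<in> cell2 K" "dom1 K (dom2 K \<alpha>) = X" "cod1 K (dom2 K \<alpha>) = Y"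
  shows "lam Y \<rhd>\<^bsub>L\<^esub> on2 (endo R) (on2 V \<alpha>) = on2 V (on2 (endo T) \<alpha>) \<lhd>\<^bsub>L\<^esub> lam X"
  using lam.natural2_cell[of \<alpha>] assms by auto

section \<open>The 1-cells \<Lambda> and their compatibility with units and multiplications\<close>

definition lam_lam :: "'o \<Rightarrow> 'n" where
  "lam_lam X = lam (on0 (endo T) X) \<odot>\<^bsub>L\<^esub> on1 (endo R) (lam X)"

text \<open>With these boundaries \<open>lam_lam\<close> can be treated as opaque; it is unfolded
  only where its two factors have to be separated.\<close>

lemma lam_lam_cell [simp]:
  assumes "X \<in> obj K"
  shows "lam_lam X \<in> cell1 L" "dom1 L (lam_lam X) = on0 (endo R) (on0 (endo R) (on0 V X))"
    "cod1 L (lam_lam X) = on0 V (on0 (endo T) (on0 (endo T) X))"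
  using assms by (simp_all add: lam_lam_def)

text \<open>Naturality of \<lambda> is used twice: at \<open>f\<close> under \<open>endo R\<close>,
  and then at the image of \<open>f\<close> under \<open>endo T\<close>.\<close>

lemma lam_lam_natural:
  assumes "f \<in> cell1 K" "dom1 K f = X" "cod1 K f = Y"
  shows "lam_lam Y \<odot>\<^bsub>L\<^esub> on1 (endo R) (on1 (endo R) (on1 V f))
    = on1 V (on1 (endo T) (on1 (endo T) f)) \<odot>\<^bsub>L\<^esub> lam_lam X"
proof -
  have "lam_lam Y \<odot>\<^bsub>L\<^esub> on1 (endo R) (on1 (endo R) (on1 V f))
      = lam (on0 (endo T) Y) \<odot>\<^bsub>L\<^esub> on1 (endo R) (lam Y \<odot>\<^bsub>L\<^esub> on1 (endo R) (on1 V f))"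
    using assms by (auto simp: lam_lam_def)
  also have "\<dots> = on1 V (on1 (endo T) (on1 (endo T) f)) \<odot>\<^bsub>L\<^esub> lam_lam X"
    using assms by (auto simp: lam_lam_def lam_natural1)
  finally show ?thesis .
qed

text \<open>The colax unit law is applied under \<open>endo R\<close>, followed by naturality of
  \<lambda> at \<open>eta T X\<close>.\<close>

lemma lam_lam_endo_eta:
  assumes "X \<in> obj K"
  shows "lam_lam X \<odot>\<^bsub>L\<^esub> on1 (endo R) (eta R (on0 V X)) = on1 V (on1 (endo T) (eta T X)) \<odot>\<^bsub>L\<^esub> lam X"
proof -
  have "lam_lam X \<odot>\<^bsub>L\<^esub> on1 (endo R) (eta R (on0 V X))
      = lam (on0 (endo T) X) \<odot>\<^bsub>L\<^esub> on1 (endo R) (lam X \<odot>\<^bsub>L\<^esub> eta R (on0 V X))"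
    using assms by (simp add: lam_lam_def)
  also have "\<dots> = on1 V (on1 (endo T) (eta T X)) \<odot>\<^bsub>L\<^esub> lam X"
    using assms by (simp add: colax_unit lam_natural1)
  finally show ?thesis .
qed

text \<open>Naturality of the unit of \<open>R\<close> at \<open>lam X\<close> moves that 1-cell to
  the right; the colax unit law then applies at \<open>on0 (endo T) X\<close>.\<close>

lemma lam_lam_eta_endo:
  assumes "X \<in> obj K"
  shows "lam_lam X \<odot>\<^bsub>L\<^esub> eta R (on0 (endo R) (on0 V X)) = on1 V (eta T (on0 (endo T) X)) \<odot>\<^bsub>L\<^esub> lam X"
proof -
  have "lam_lam X \<odot>\<^bsub>L\<^esub> eta R (on0 (endo R) (on0 V X))
      = (lam (on0 (endo T) X) \<odot>\<^bsub>L\<^esub> eta R (on0 V (on0 (endo T) X))) \<odot>\<^bsub>L\<^esub> lam X"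
    using assms by (simp add: lam_lam_def R.eta_natural)
  also have "\<dots> = on1 V (eta T (on0 (endo T) X)) \<odot>\<^bsub>L\<^esub> lam X"
    using assms by (simp add: colax_unit)
  finally show ?thesis .
qed

lemma colax_mult_lam_lam:
  assumes "X \<in> obj K"
  shows "lam X \<odot>\<^bsub>L\<^esub> mu R (on0 V X) = on1 V (mu T X) \<odot>\<^bsub>L\<^esub> lam_lam X"
  using assms by (simp add: colax_mult lam_lam_def)

text \<open>The colax multiplication law is applied under \<open>endo R\<close>, followed by
  naturality of \<lambda> at \<open>mu T X\<close>.\<close>

lemma lam_lam_endo_mu:
  assumes "X \<in> obj K"
  shows "lam_lam X \<odot>\<^bsub>L\<^esub> on1 (endo R) (mu R (on0 V X))
    = on1 V (on1 (endo T) (mu T X)) \<odot>\<^bsub>L\<^esub> lam (on0 (endo T) (on0 (endo T) X)) \<odot>\<^bsub>L\<^esub> on1 (endo R) (lam_lam X)"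
proof -
  have "lam_lam X \<odot>\<^bsub>L\<^esub> on1 (endo R) (mu R (on0 V X))
      = lam (on0 (endo T) X) \<odot>\<^bsub>L\<^esub> on1 (endo R) (lam X \<odot>\<^bsub>L\<^esub> mu R (on0 V X))"
    using assms by (simp add: lam_lam_def)
  also have "\<dots> = on1 V (on1 (endo T) (mu T X)) \<odot>\<^bsub>L\<^esub> lam (on0 (endo T) (on0 (endo T) X))
      \<odot>\<^bsub>L\<^esub> on1 (endo R) (lam_lam X)"
    using assms by (simp add: colax_mult_lam_lam lam_natural1)
  finally show ?thesis .
qed

text \<open>Here naturality of the multiplication of \<open>R\<close> at \<open>lam X\<close> comes
  first, then the colax multiplication law at \<open>on0 (endo T) X\<close>. The two bracketings of
  the threefold comparison coincide by functoriality of \<open>endo R\<close>.\<close>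

lemma lam_lam_mu_endo:
  assumes "X \<in> obj K"
  shows "lam_lam X \<odot>\<^bsub>L\<^esub> mu R (on0 (endo R) (on0 V X))
    = on1 V (mu T (on0 (endo T) X)) \<odot>\<^bsub>L\<^esub> lam (on0 (endo T) (on0 (endo T) X)) \<odot>\<^bsub>L\<^esub> on1 (endo R) (lam_lam X)"
proof -
  have "lam_lam X \<odot>\<^bsub>L\<^esub> mu R (on0 (endo R) (on0 V X))
      = (lam (on0 (endo T) X) \<odot>\<^bsub>L\<^esub> mu R (on0 V (on0 (endo T) X))) \<odot>\<^bsub>L\<^esub> on1 (endo R) (on1 (endo R) (lam X))"
    using assms by (simp add: lam_lam_def R.mu_natural)
  also have "\<dots> = on1 V (mu T (on0 (endo T) X)) \<odot>\<^bsub>L\<^esub> lam (on0 (endo T) (on0 (endo T) X))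
      \<odot>\<^bsub>L\<^esub> on1 (endo R) (lam_lam X)"
    unfolding colax_mult_lam_lam[OF S.endo.on0_obj[OF assms]] using assms by (simp add: lam_lam_def)
  finally show ?thesis .
qed

section \<open>Restricted actions, their boundaries and whiskering identities\<close>

abbreviation (input) "res_alg \<equiv> restrict_psalg T L R V lam"
abbreviation (input) "res_mor \<equiv> restrict_psmor T L R V lam"

lemma restrict_psalg_simps [simp]:
  "base_ob (res_alg A) = on0 V (base_ob A)"
  "act (res_alg A) = on1 V (act A) \<odot>\<^bsub>L\<^esub> lam (base_ob A)"
  "unit_cell (res_alg A) = on2 V (unit_cell A)"
  "mult_cell (res_alg A) = on2 V (mult_cell A) \<lhd>\<^bsub>L\<^esub> lam_lam (base_ob A)"
  by (simp_all add: restrict_psalg_def lam_lam_def)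

lemma restrict_psmor_simps [simp]:
  "msrc (res_mor p) = res_alg (msrc p)" "mtrg (res_mor p) = res_alg (mtrg p)"
  "mmap (res_mor p) = on1 V (mmap p)"
  "mcell (res_mor p) = on2 V (mcell p) \<lhd>\<^bsub>L\<^esub> lam (base_ob (msrc p))"
  by (simp_all add: restrict_psmor_def)

text \<open>Naturality of \<lambda> at \<open>a\<close> moves the inner \<lambda> to the right,
  where it completes \<Lambda>. This gives the source of the restricted multiplication cell.\<close>

lemma restrict_act_square:
  assumes "a \<in> cell1 K" "dom1 K a = on0 (endo T) X" "cod1 K a = X" "X \<in> obj K"
  shows "(on1 V a \<odot>\<^bsub>L\<^esub> lam X) \<odot>\<^bsub>L\<^esub> on1 (endo R) (on1 V a \<odot>\<^bsub>L\<^esub> lam X)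
    = on1 V a \<odot>\<^bsub>L\<^esub> on1 V (on1 (endo T) a) \<odot>\<^bsub>L\<^esub> lam_lam X"
  using assms by (simp add: lam_lam_def lam_natural1)

lemma restrict_act_mu:
  assumes "a \<in> cell1 K" "dom1 K a = on0 (endo T) X" "cod1 K a = X" "X \<in> obj K"
  shows "(on1 V a \<odot>\<^bsub>L\<^esub> lam X) \<odot>\<^bsub>L\<^esub> mu R (on0 V X) = on1 V a \<odot>\<^bsub>L\<^esub> on1 V (mu T X) \<odot>\<^bsub>L\<^esub> lam_lam X"
  using assms by (simp add: colax_mult_lam_lam)

text \<open>2-naturality of \<lambda>, whiskered by \<open>on1 V a\<close>. It converts the terms of
  the axioms in which the action of \<open>R\<close> is whiskered onto an image under
  \<open>endo R\<close>.\<close>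

lemma whisker_lam_natural2:
  assumes "\<alpha> \<in> cell2 K" "dom1 K (dom2 K \<alpha>) = X" "cod1 K (dom2 K \<alpha>) = Y"
    "a \<in> cell1 K" "dom1 K a = on0 (endo T) Y"
  shows "(on1 V a \<odot>\<^bsub>L\<^esub> lam Y) \<rhd>\<^bsub>L\<^esub> on2 (endo R) (on2 V \<alpha>)
    = on2 V (a \<rhd>\<^bsub>K\<^esub> on2 (endo T) \<alpha>) \<lhd>\<^bsub>L\<^esub> lam X"
proof -
  have "X \<in> obj K" "Y \<in> obj K" using assms by auto
  then have "(on1 V a \<odot>\<^bsub>L\<^esub> lam Y) \<rhd>\<^bsub>L\<^esub> on2 (endo R) (on2 V \<alpha>)
      = on1 V a \<rhd>\<^bsub>L\<^esub> (lam Y \<rhd>\<^bsub>L\<^esub> on2 (endo R) (on2 V \<alpha>))"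
    using assms by simp
  also have "\<dots> = on2 V (a \<rhd>\<^bsub>K\<^esub> on2 (endo T) \<alpha>) \<lhd>\<^bsub>L\<^esub> lam X"
    using assms \<open>X \<in> obj K\<close> by (simp add: lam_natural2)
  finally show ?thesis .
qed

text \<open>The simplifier splits \<open>V\<close> over composites, which breaks the pattern of
  \<open>eta_natural\<close>; this is the same square after splitting.\<close>

lemma V_eta_natural:
  assumes "f \<in> cell1 K" "dom1 K f = X" "cod1 K f = Y"
  shows "on1 V (on1 (endo T) f) \<odot>\<^bsub>L\<^esub> on1 V (eta T X) = on1 V (eta T Y) \<odot>\<^bsub>L\<^esub> on1 V f"
  using arg_cong[OF S.eta_natural(1)[OF assms], of "on1 V"] assms by auto

lemma V_mu_natural:
  assumes "f \<in> cell1 K" "dom1 K f = X" "cod1 K f = Y"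
  shows "on1 V (on1 (endo T) f) \<odot>\<^bsub>L\<^esub> on1 V (mu T X)
    = on1 V (mu T Y) \<odot>\<^bsub>L\<^esub> on1 V (on1 (endo T) (on1 (endo T) f))"
  using arg_cong[OF S.mu_natural(1)[OF assms], of "on1 V"] assms by auto

lemma is_psalg_restrict:
  assumes A: "is_psalg K T A"
  shows "is_psalg L R (res_alg A)"
proof -
  define X a \<iota> \<chi> where "X = base_ob A" and "a = act A" and "\<iota> = unit_cell A" and "\<chi> = mult_cell A"
  note defs = X_def a_def \<iota>_def \<chi>_def
  note laws = S.psalg_laws[OF A, folded defs]
  let ?c = "on1 V a \<odot>\<^bsub>L\<^esub> lam X"
  have cells [simp]: "X \<in> obj K"
    "a \<in> cell1 K" "dom1 K a = on0 (endo T) X" "cod1 K a = X"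
    "\<iota> \<in> cell2 K" "dom2 K \<iota> = id1 K X" "cod2 K \<iota> = a \<odot>\<^bsub>K\<^esub> eta T X"
    "\<chi> \<in> cell2 K" "dom2 K \<chi> = a \<odot>\<^bsub>K\<^esub> on1 (endo T) a" "cod2 K \<chi> = a \<odot>\<^bsub>K\<^esub> mu T X"
    using A by (simp_all add: defs)
  have inv: "invertible2 L (on2 V \<iota>)" "invertible2 L (on2 V \<chi> \<lhd>\<^bsub>L\<^esub> lam_lam X)"
    using S.psalg_invertible[OF A]
    by (auto simp: defs[symmetric] intro!: V.invertible2_on2 R.endo.C.invertible2_hcomp R.endo.C.invertible2_id2)
  \<comment> \<open>Both factors acquire a trailing \<open>lam X\<close>: the first by
    \<open>lam_lam_endo_eta\<close>, the second by 2-naturality of \<lambda>. Factoring it out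
    leaves the first unit law of \<open>A\<close> under \<open>V\<close>.\<close>
  have "((on2 V \<chi> \<lhd>\<^bsub>L\<^esub> lam_lam X) \<lhd>\<^bsub>L\<^esub> on1 (endo R) (eta R (on0 V X)))
        \<cdot>\<^bsub>L\<^esub> (?c \<rhd>\<^bsub>L\<^esub> on2 (endo R) (on2 V \<iota>))
      = on2 V ((\<chi> \<lhd>\<^bsub>K\<^esub> on1 (endo T) (eta T X)) \<cdot>\<^bsub>K\<^esub> (a \<rhd>\<^bsub>K\<^esub> on2 (endo T) \<iota>)) \<lhd>\<^bsub>L\<^esub> lam X"
    by (simp add: whisker_lam_natural2 lam_lam_endo_eta)
  also have "\<dots> = id2 L ?c"
    unfolding laws(1) by simp
  finally have unit1: "((on2 V \<chi> \<lhd>\<^bsub>L\<^esub> lam_lam X) \<lhd>\<^bsub>L\<^esub> on1 (endo R) (eta R (on0 V X)))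
        \<cdot>\<^bsub>L\<^esub> (?c \<rhd>\<^bsub>L\<^esub> on2 (endo R) (on2 V \<iota>)) = id2 L ?c" .
  \<comment> \<open>The restricted action already ends in \<open>lam X\<close>, so only the first
    factor changes. Naturality of the unit of \<open>T\<close> at \<open>a\<close> matches the
    boundaries of the vertical composite.\<close>
  have "((on2 V \<chi> \<lhd>\<^bsub>L\<^esub> lam_lam X) \<lhd>\<^bsub>L\<^esub> eta R (on0 (endo R) (on0 V X))) \<cdot>\<^bsub>L\<^esub> (on2 V \<iota> \<lhd>\<^bsub>L\<^esub> ?c)
      = on2 V ((\<chi> \<lhd>\<^bsub>K\<^esub> eta T (on0 (endo T) X)) \<cdot>\<^bsub>K\<^esub> (\<iota> \<lhd>\<^bsub>K\<^esub> a)) \<lhd>\<^bsub>L\<^esub> lam X"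
    by (simp add: lam_lam_eta_endo S.eta_natural V_eta_natural)
  also have "\<dots> = id2 L ?c"
    unfolding laws(2) by simp
  finally have unit2: "((on2 V \<chi> \<lhd>\<^bsub>L\<^esub> lam_lam X) \<lhd>\<^bsub>L\<^esub> eta R (on0 (endo R) (on0 V X)))
      \<cdot>\<^bsub>L\<^esub> (on2 V \<iota> \<lhd>\<^bsub>L\<^esub> ?c) = id2 L ?c" .
  let ?\<Lambda>\<^sub>3 = "lam (on0 (endo T) (on0 (endo T) X)) \<odot>\<^bsub>L\<^esub> on1 (endo R) (lam_lam X)"
  \<comment> \<open>Each of the four cells in the associativity law is now written as an image under
    \<open>V\<close> whiskered by \<open>?\<Lambda>\<^sub>3\<close>.\<close>
  have mu1: "(on2 V \<chi> \<lhd>\<^bsub>L\<^esub> lam_lam X) \<lhd>\<^bsub>L\<^esub> on1 (endo R) (mu R (on0 V X))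
      = on2 V (\<chi> \<lhd>\<^bsub>K\<^esub> on1 (endo T) (mu T X)) \<lhd>\<^bsub>L\<^esub> ?\<Lambda>\<^sub>3"
    by (simp add: lam_lam_endo_mu)
  have mu2: "(on2 V \<chi> \<lhd>\<^bsub>L\<^esub> lam_lam X) \<lhd>\<^bsub>L\<^esub> mu R (on0 (endo R) (on0 V X))
      = on2 V (\<chi> \<lhd>\<^bsub>K\<^esub> mu T (on0 (endo T) X)) \<lhd>\<^bsub>L\<^esub> ?\<Lambda>\<^sub>3"
    by (simp add: lam_lam_mu_endo)
  have "?c \<rhd>\<^bsub>L\<^esub> on2 (endo R) (on2 V \<chi> \<lhd>\<^bsub>L\<^esub> lam_lam X)
      = (?c \<rhd>\<^bsub>L\<^esub> on2 (endo R) (on2 V \<chi>)) \<lhd>\<^bsub>L\<^esub> on1 (endo R) (lam_lam X)"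
    by simp
  \<comment> \<open>The 1-cells bounding \<chi> start at the twofold image of \<open>X\<close> under
    \<open>endo T\<close>, so 2-naturality puts \<lambda> there; with the trailing
    \<open>on1 (endo R) (lam_lam X)\<close> it forms \<open>?\<Lambda>\<^sub>3\<close>.\<close>
  also have "\<dots> = on2 V (a \<rhd>\<^bsub>K\<^esub> on2 (endo T) \<chi>) \<lhd>\<^bsub>L\<^esub> ?\<Lambda>\<^sub>3"
    by (subst whisker_lam_natural2[of \<chi> "on0 (endo T) (on0 (endo T) X)" X]) simp_all
  finally have act_mult: "?c \<rhd>\<^bsub>L\<^esub> on2 (endo R) (on2 V \<chi> \<lhd>\<^bsub>L\<^esub> lam_lam X)
      = on2 V (a \<rhd>\<^bsub>K\<^esub> on2 (endo T) \<chi>) \<lhd>\<^bsub>L\<^esub> ?\<Lambda>\<^sub>3" .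
  \<comment> \<open>The grouping exposes naturality of \<Lambda> at \<open>a\<close>; the remaining
    comparisons reassemble to \<open>?\<Lambda>\<^sub>3\<close>.\<close>
  have "lam_lam X \<odot>\<^bsub>L\<^esub> on1 (endo R) (on1 (endo R) ?c)
      = (lam_lam X \<odot>\<^bsub>L\<^esub> on1 (endo R) (on1 (endo R) (on1 V a))) \<odot>\<^bsub>L\<^esub> on1 (endo R) (on1 (endo R) (lam X))"
    by simp
  also have "\<dots> = on1 V (on1 (endo T) (on1 (endo T) a)) \<odot>\<^bsub>L\<^esub> ?\<Lambda>\<^sub>3"
    by (subst lam_lam_natural[of a "on0 (endo T) X" X]) (simp_all add: lam_lam_def)
  finally have mult_act: "(on2 V \<chi> \<lhd>\<^bsub>L\<^esub> lam_lam X) \<lhd>\<^bsub>L\<^esub> on1 (endo R) (on1 (endo R) ?c)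
      = on2 V (\<chi> \<lhd>\<^bsub>K\<^esub> on1 (endo T) (on1 (endo T) a)) \<lhd>\<^bsub>L\<^esub> ?\<Lambda>\<^sub>3"
    by simp
  have "((on2 V \<chi> \<lhd>\<^bsub>L\<^esub> lam_lam X) \<lhd>\<^bsub>L\<^esub> on1 (endo R) (mu R (on0 V X)))
        \<cdot>\<^bsub>L\<^esub> (?c \<rhd>\<^bsub>L\<^esub> on2 (endo R) (on2 V \<chi> \<lhd>\<^bsub>L\<^esub> lam_lam X))
      = on2 V ((\<chi> \<lhd>\<^bsub>K\<^esub> on1 (endo T) (mu T X)) \<cdot>\<^bsub>K\<^esub> (a \<rhd>\<^bsub>K\<^esub> on2 (endo T) \<chi>)) \<lhd>\<^bsub>L\<^esub> ?\<Lambda>\<^sub>3"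
    unfolding mu1 act_mult by (simp add: S.mu_natural)
  also have "\<dots> = ((on2 V \<chi> \<lhd>\<^bsub>L\<^esub> lam_lam X) \<lhd>\<^bsub>L\<^esub> mu R (on0 (endo R) (on0 V X)))
        \<cdot>\<^bsub>L\<^esub> ((on2 V \<chi> \<lhd>\<^bsub>L\<^esub> lam_lam X) \<lhd>\<^bsub>L\<^esub> on1 (endo R) (on1 (endo R) ?c))"
    unfolding laws(3) mu2 mult_act by (simp add: S.mu_natural V_mu_natural)
  finally have mult: "((on2 V \<chi> \<lhd>\<^bsub>L\<^esub> lam_lam X) \<lhd>\<^bsub>L\<^esub> on1 (endo R) (mu R (on0 V X)))
        \<cdot>\<^bsub>L\<^esub> (?c \<rhd>\<^bsub>L\<^esub> on2 (endo R) (on2 V \<chi> \<lhd>\<^bsub>L\<^esub> lam_lam X))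
      = ((on2 V \<chi> \<lhd>\<^bsub>L\<^esub> lam_lam X) \<lhd>\<^bsub>L\<^esub> mu R (on0 (endo R) (on0 V X)))
        \<cdot>\<^bsub>L\<^esub> ((on2 V \<chi> \<lhd>\<^bsub>L\<^esub> lam_lam X) \<lhd>\<^bsub>L\<^esub> on1 (endo R) (on1 (endo R) ?c))" .
  show ?thesis
  proof (rule R.is_psalgI, goal_cases)
    case 1 show ?case by (simp flip: defs)
  next
    case 2 show ?case by (simp add: hom1_def flip: defs)
  next
    case 3 show ?case by (simp add: hom2_def colax_unit flip: defs)
  next
    case 4 show ?case using inv by (simp flip: defs)
  next
    case 5 show ?case using restrict_act_square[of a X] restrict_act_mu[of a X]
      by (simp add: hom2_def flip: defs)
  next
    case 6 show ?case using inv by (simp flip: defs)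
  next
    case 7 show ?case using unit1 unfolding restrict_psalg_simps defs .
  next
    case 8 show ?case using unit2 unfolding restrict_psalg_simps defs .
  next
    case 9 show ?case using mult unfolding restrict_psalg_simps defs .
  qed
qed

text \<open>For the unit law the colax unit axiom absorbs \<lambda>, leaving the image under
  \<open>V\<close> of the law of \<open>p\<close>. All cells of the multiplication law end in
  \<Lambda> at the source, which is factored out.\<close>

lemma is_psmor_restrict:
  assumes p: "is_psmor K T p"
  shows "is_psmor L R (res_mor p)"
proof -
  define X Y a b f \<phi> where "X = base_ob (msrc p)" and "Y = base_ob (mtrg p)"
    and "a = act (msrc p)" and "b = act (mtrg p)" and "f = mmap p" and "\<phi> = mcell p"
  define \<iota>\<^sub>a \<iota>\<^sub>b \<chi>\<^sub>a \<chi>\<^sub>b where "\<iota>\<^sub>a = unit_cell (msrc p)" and "\<iota>\<^sub>b = unit_cell (mtrg p)"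
    and "\<chi>\<^sub>a = mult_cell (msrc p)" and "\<chi>\<^sub>b = mult_cell (mtrg p)"
  note defs = X_def Y_def a_def b_def f_def \<phi>_def \<iota>\<^sub>a_def \<iota>\<^sub>b_def \<chi>\<^sub>a_def \<chi>\<^sub>b_def
  note laws = S.psmor_laws[OF p, folded defs]
  have cells [simp]: "X \<in> obj K" "Y \<in> obj K"
    "a \<in> cell1 K" "dom1 K a = on0 (endo T) X" "cod1 K a = X"
    "b \<in> cell1 K" "dom1 K b = on0 (endo T) Y" "cod1 K b = Y"
    "f \<in> cell1 K" "dom1 K f = X" "cod1 K f = Y"
    "\<phi> \<in> cell2 K" "dom2 K \<phi> = b \<odot>\<^bsub>K\<^esub> on1 (endo T) f" "cod2 K \<phi> = f \<odot>\<^bsub>K\<^esub> a"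
    "\<iota>\<^sub>a \<in> cell2 K" "dom2 K \<iota>\<^sub>a = id1 K X" "cod2 K \<iota>\<^sub>a = a \<odot>\<^bsub>K\<^esub> eta T X"
    "\<iota>\<^sub>b \<in> cell2 K" "dom2 K \<iota>\<^sub>b = id1 K Y" "cod2 K \<iota>\<^sub>b = b \<odot>\<^bsub>K\<^esub> eta T Y"
    "\<chi>\<^sub>a \<in> cell2 K" "dom2 K \<chi>\<^sub>a = a \<odot>\<^bsub>K\<^esub> on1 (endo T) a" "cod2 K \<chi>\<^sub>a = a \<odot>\<^bsub>K\<^esub> mu T X"
    "\<chi>\<^sub>b \<in> cell2 K" "dom2 K \<chi>\<^sub>b = b \<odot>\<^bsub>K\<^esub> on1 (endo T) b" "cod2 K \<chi>\<^sub>b = b \<odot>\<^bsub>K\<^esub> mu T Y"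
    using p by (simp_all add: defs)
  let ?\<phi> = "on2 V \<phi> \<lhd>\<^bsub>L\<^esub> lam X"
  have inv: "invertible2 L ?\<phi>"
    using S.psmor_invertible[OF p]
    by (auto simp: defs[symmetric] intro!: V.invertible2_on2 R.endo.C.invertible2_hcomp R.endo.C.invertible2_id2)
  have "(?\<phi> \<lhd>\<^bsub>L\<^esub> eta R (on0 V X)) \<cdot>\<^bsub>L\<^esub> (on2 V \<iota>\<^sub>b \<lhd>\<^bsub>L\<^esub> on1 V f)
      = on2 V ((\<phi> \<lhd>\<^bsub>K\<^esub> eta T X) \<cdot>\<^bsub>K\<^esub> (\<iota>\<^sub>b \<lhd>\<^bsub>K\<^esub> f))"
    by (simp add: colax_unit S.eta_natural)
  also have "\<dots> = on1 V f \<rhd>\<^bsub>L\<^esub> on2 V \<iota>\<^sub>a"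
    unfolding laws(1) by simp
  finally have unit: "(?\<phi> \<lhd>\<^bsub>L\<^esub> eta R (on0 V X)) \<cdot>\<^bsub>L\<^esub> (on2 V \<iota>\<^sub>b \<lhd>\<^bsub>L\<^esub> on1 V f)
      = on1 V f \<rhd>\<^bsub>L\<^esub> on2 V \<iota>\<^sub>a" .
  have mu: "?\<phi> \<lhd>\<^bsub>L\<^esub> mu R (on0 V X) = on2 V (\<phi> \<lhd>\<^bsub>K\<^esub> mu T X) \<lhd>\<^bsub>L\<^esub> lam_lam X"
    by (simp add: colax_mult_lam_lam)
  have mult_map: "(on2 V \<chi>\<^sub>b \<lhd>\<^bsub>L\<^esub> lam_lam Y) \<lhd>\<^bsub>L\<^esub> on1 (endo R) (on1 (endo R) (on1 V f))
      = on2 V (\<chi>\<^sub>b \<lhd>\<^bsub>K\<^esub> on1 (endo T) (on1 (endo T) f)) \<lhd>\<^bsub>L\<^esub> lam_lam X"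
    by (simp add: lam_lam_natural)
  \<comment> \<open>Naturality of \<lambda> at \<open>a\<close> turns the two copies of
    \<open>lam X\<close> into \<open>lam_lam X\<close>.\<close>
  have cell_act: "?\<phi> \<lhd>\<^bsub>L\<^esub> on1 (endo R) (on1 V a \<odot>\<^bsub>L\<^esub> lam X)
      = on2 V (\<phi> \<lhd>\<^bsub>K\<^esub> on1 (endo T) a) \<lhd>\<^bsub>L\<^esub> lam_lam X"
    by (simp add: lam_natural1 lam_lam_def)
  have "(on1 V b \<odot>\<^bsub>L\<^esub> lam Y) \<rhd>\<^bsub>L\<^esub> on2 (endo R) ?\<phi>
      = ((on1 V b \<odot>\<^bsub>L\<^esub> lam Y) \<rhd>\<^bsub>L\<^esub> on2 (endo R) (on2 V \<phi>)) \<lhd>\<^bsub>L\<^esub> on1 (endo R) (lam X)"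
    by simp
  \<comment> \<open>The source object of \<phi> is \<open>on0 (endo T) X\<close>, so 2-naturality
    produces \<lambda> there; this is the outer factor of \<Lambda>.\<close>
  also have "\<dots> = on2 V (b \<rhd>\<^bsub>K\<^esub> on2 (endo T) \<phi>) \<lhd>\<^bsub>L\<^esub> lam_lam X"
    by (subst whisker_lam_natural2[of \<phi> "on0 (endo T) X" Y]) (simp_all add: lam_lam_def)
  finally have act_cell: "(on1 V b \<odot>\<^bsub>L\<^esub> lam Y) \<rhd>\<^bsub>L\<^esub> on2 (endo R) ?\<phi>
      = on2 V (b \<rhd>\<^bsub>K\<^esub> on2 (endo T) \<phi>) \<lhd>\<^bsub>L\<^esub> lam_lam X" .
  have "(?\<phi> \<lhd>\<^bsub>L\<^esub> mu R (on0 V X))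
        \<cdot>\<^bsub>L\<^esub> ((on2 V \<chi>\<^sub>b \<lhd>\<^bsub>L\<^esub> lam_lam Y) \<lhd>\<^bsub>L\<^esub> on1 (endo R) (on1 (endo R) (on1 V f)))
      = on2 V ((\<phi> \<lhd>\<^bsub>K\<^esub> mu T X) \<cdot>\<^bsub>K\<^esub> (\<chi>\<^sub>b \<lhd>\<^bsub>K\<^esub> on1 (endo T) (on1 (endo T) f))) \<lhd>\<^bsub>L\<^esub> lam_lam X"
    unfolding mu mult_map by (simp add: S.mu_natural V_mu_natural)
  also have "\<dots> = (on1 V f \<rhd>\<^bsub>L\<^esub> (on2 V \<chi>\<^sub>a \<lhd>\<^bsub>L\<^esub> lam_lam X))
        \<cdot>\<^bsub>L\<^esub> (?\<phi> \<lhd>\<^bsub>L\<^esub> on1 (endo R) (on1 V a \<odot>\<^bsub>L\<^esub> lam X))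
        \<cdot>\<^bsub>L\<^esub> ((on1 V b \<odot>\<^bsub>L\<^esub> lam Y) \<rhd>\<^bsub>L\<^esub> on2 (endo R) ?\<phi>)"
    unfolding laws(2) cell_act act_cell by simp
  finally have mult: "(?\<phi> \<lhd>\<^bsub>L\<^esub> mu R (on0 V X))
        \<cdot>\<^bsub>L\<^esub> ((on2 V \<chi>\<^sub>b \<lhd>\<^bsub>L\<^esub> lam_lam Y) \<lhd>\<^bsub>L\<^esub> on1 (endo R) (on1 (endo R) (on1 V f)))
      = (on1 V f \<rhd>\<^bsub>L\<^esub> (on2 V \<chi>\<^sub>a \<lhd>\<^bsub>L\<^esub> lam_lam X))
        \<cdot>\<^bsub>L\<^esub> (?\<phi> \<lhd>\<^bsub>L\<^esub> on1 (endo R) (on1 V a \<odot>\<^bsub>L\<^esub> lam X))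
        \<cdot>\<^bsub>L\<^esub> ((on1 V b \<odot>\<^bsub>L\<^esub> lam Y) \<rhd>\<^bsub>L\<^esub> on2 (endo R) ?\<phi>)" .
  show ?thesis
  proof (rule R.is_psmorI, goal_cases)
    case 1 show ?case using p by (simp add: is_psalg_restrict)
  next
    case 2 show ?case using p by (simp add: is_psalg_restrict)
  next
    case 3 show ?case by (simp add: hom1_def flip: defs)
  next
    case 4 show ?case by (simp add: hom2_def lam_natural1 flip: defs)
  next
    case 5 show ?case using inv by (simp flip: defs)
  next
    case 6 show ?case using unit unfolding restrict_psalg_simps restrict_psmor_simps defs .
  next
    case 7 show ?case using mult unfolding restrict_psalg_simps restrict_psmor_simps defs .
  qed
qed

text \<open>The law of \<open>t\<close> is applied under \<open>V\<close> and whiskered by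
  \<open>lam X\<close>; 2-naturality of \<lambda> then rewrites the term containing the target
  action.\<close>

lemma is_algtrans_restrict:
  assumes t: "is_algtrans K T t"
  shows "is_algtrans L R \<lparr>tsrc = res_mor (tsrc t), tcell = on2 V (tcell t), ttrg = res_mor (ttrg t)\<rparr>"
proof -
  define X a b \<alpha> where "X = base_ob (msrc (tsrc t))" and "a = act (msrc (tsrc t))"
    and "b = act (mtrg (tsrc t))" and "\<alpha> = tcell t"
  note defs = X_def a_def b_def \<alpha>_def
  let ?c = "on1 V b \<odot>\<^bsub>L\<^esub> lam (base_ob (mtrg (tsrc t)))"
  have "(on2 V \<alpha> \<lhd>\<^bsub>L\<^esub> (on1 V a \<odot>\<^bsub>L\<^esub> lam X)) \<cdot>\<^bsub>L\<^esub> (on2 V (mcell (tsrc t)) \<lhd>\<^bsub>L\<^esub> lam X)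
      = on2 V ((\<alpha> \<lhd>\<^bsub>K\<^esub> a) \<cdot>\<^bsub>K\<^esub> mcell (tsrc t)) \<lhd>\<^bsub>L\<^esub> lam X"
    using t by (simp add: defs)
  also have "\<dots> = (on2 V (mcell (ttrg t)) \<lhd>\<^bsub>L\<^esub> lam X) \<cdot>\<^bsub>L\<^esub> (on2 V (b \<rhd>\<^bsub>K\<^esub> on2 (endo T) \<alpha>) \<lhd>\<^bsub>L\<^esub> lam X)"
    unfolding S.algtrans_law[OF t, folded defs] using t by (simp add: defs)
  also have "on2 V (b \<rhd>\<^bsub>K\<^esub> on2 (endo T) \<alpha>) \<lhd>\<^bsub>L\<^esub> lam X = ?c \<rhd>\<^bsub>L\<^esub> on2 (endo R) (on2 V \<alpha>)"
    by (rule whisker_lam_natural2[symmetric]) (use t in \<open>simp_all add: defs\<close>)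
  finally show ?thesis
    by (intro R.is_algtransI) (use t in \<open>simp_all add: hom2_def is_psmor_restrict defs\<close>)
qed

section \<open>The restriction 2-functor and the explicit form of its values\<close>

lemma restrict_ps_simps [simp]:
  "on0 (restrict_ps T L R V lam) = res_alg"
  "on1 (restrict_ps T L R V lam) = res_mor"
  "on2 (restrict_ps T L R V lam) t
    = \<lparr>tsrc = res_mor (tsrc t), tcell = on2 V (tcell t), ttrg = res_mor (ttrg t)\<rparr>"
  by (simp_all add: restrict_ps_def)

lemma restrict_psmor_id:
  assumes "is_psalg K T A"
  shows "res_mor (id_psmor K A) = id_psmor L (res_alg A)"
  by (rule psmor.equality) (use assms in simp_all)

text \<open>For the comparison cells, naturality of \<lambda> at \<open>mmap p\<close> lets the
  comparison of \<open>q\<close>, restricted at its own source, be whiskered by the image of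
  \<open>mmap p\<close>.\<close>

lemma restrict_psmor_comp:
  assumes "is_psmor K T p" "is_psmor K T q" "mtrg p = msrc q"
  shows "res_mor (comp_psmor K T q p) = comp_psmor L R (res_mor q) (res_mor p)"
  by (rule psmor.equality) (use assms in \<open>simp_all add: lam_natural1\<close>)

lemma two_functor_restrict_ps: "two_functor (PsAlg K T) (PsAlg L R) (restrict_ps T L R V lam)"
proof (intro two_functor.intro S.two_category_PsAlg R.two_category_PsAlg, unfold_locales)
qed (simp_all add: hom1_def hom2_def is_psalg_restrict is_psmor_restrict is_algtrans_restrict
  restrict_psmor_id restrict_psmor_comp)

lemma restrict_ps_over:
  "map_eq_on (PsAlg K T) (comp_map forget (restrict_ps T L R V lam)) (comp_map V forget)"
  by (simp add: map_eq_on_def forget_def)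

text \<open>The unit cell of the restriction is the image of the original one, and \<open>V\<close>
  preserves identity 2-cells.\<close>

lemma normal_psalg_restrict:
  "normal_psalg K T A \<Longrightarrow> normal_psalg L R (res_alg A)"
  unfolding normal_psalg_def using is_psalg_restrict by force

text \<open>Types the displayed cells and identifies their boundary composites: the colax unit law
  types the unit cell, and the two restricted-action identities give the ends of the multiplication
  cell.\<close>

lemma restrict_action:
  assumes "is_psalg K T \<lparr>base_ob = X, act = a, unit_cell = \<iota>, mult_cell = \<chi>\<rparr>"
  defines "c \<equiv> on1 V a \<odot>\<^bsub>L\<^esub> lam X"
    and "\<Lambda> \<equiv> lam (on0 (endo T) X) \<odot>\<^bsub>L\<^esub> on1 (endo R) (lam X)"
  shows "c \<in> hom1 L (on0 (endo R) (on0 V X)) (on0 V X)"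
    "on2 V \<iota> \<in> hom2 L (id1 L (on0 V X)) (c \<odot>\<^bsub>L\<^esub> eta R (on0 V X))"
    "c \<odot>\<^bsub>L\<^esub> on1 (endo R) c = on1 V a \<odot>\<^bsub>L\<^esub> on1 V (on1 (endo T) a) \<odot>\<^bsub>L\<^esub> \<Lambda>"
    "on2 V \<chi> \<lhd>\<^bsub>L\<^esub> \<Lambda> \<in> hom2 L (on1 V a \<odot>\<^bsub>L\<^esub> on1 V (on1 (endo T) a) \<odot>\<^bsub>L\<^esub> \<Lambda>)
      (on1 V a \<odot>\<^bsub>L\<^esub> on1 V (mu T X) \<odot>\<^bsub>L\<^esub> \<Lambda>)"
    "on1 V a \<odot>\<^bsub>L\<^esub> on1 V (mu T X) \<odot>\<^bsub>L\<^esub> \<Lambda> = c \<odot>\<^bsub>L\<^esub> mu R (on0 V X)"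
proof -
  have [simp]: "X \<in> obj K"
    "a \<in> cell1 K" "dom1 K a = on0 (endo T) X" "cod1 K a = X"
    "\<iota> \<in> cell2 K" "dom2 K \<iota> = id1 K X" "cod2 K \<iota> = a \<odot>\<^bsub>K\<^esub> eta T X"
    "\<chi> \<in> cell2 K" "dom2 K \<chi> = a \<odot>\<^bsub>K\<^esub> on1 (endo T) a" "cod2 K \<chi> = a \<odot>\<^bsub>K\<^esub> mu T X"
    using S.psalg_cells[OF assms(1)] by simp_all
  have \<Lambda>: "\<Lambda> = lam_lam X"
    by (simp add: \<Lambda>_def lam_lam_def)
  show "c \<in> hom1 L (on0 (endo R) (on0 V X)) (on0 V X)"
    "on2 V \<iota> \<in> hom2 L (id1 L (on0 V X)) (c \<odot>\<^bsub>L\<^esub> eta R (on0 V X))"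
    "on2 V \<chi> \<lhd>\<^bsub>L\<^esub> \<Lambda> \<in> hom2 L (on1 V a \<odot>\<^bsub>L\<^esub> on1 V (on1 (endo T) a) \<odot>\<^bsub>L\<^esub> \<Lambda>)
      (on1 V a \<odot>\<^bsub>L\<^esub> on1 V (mu T X) \<odot>\<^bsub>L\<^esub> \<Lambda>)"
    by (simp_all add: hom1_def hom2_def c_def \<Lambda> colax_unit)
  show "c \<odot>\<^bsub>L\<^esub> on1 (endo R) c = on1 V a \<odot>\<^bsub>L\<^esub> on1 V (on1 (endo T) a) \<odot>\<^bsub>L\<^esub> \<Lambda>"
    unfolding c_def \<Lambda> by (rule restrict_act_square) simp_all
  show "on1 V a \<odot>\<^bsub>L\<^esub> on1 V (mu T X) \<odot>\<^bsub>L\<^esub> \<Lambda> = c \<odot>\<^bsub>L\<^esub> mu R (on0 V X)"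
    unfolding c_def \<Lambda> by (rule restrict_act_mu[symmetric]) simp_all
qed

lemma restrict_comparison:
  assumes "is_psmor K T \<lparr>msrc = A, mmap = f, mcell = \<phi>, mtrg = B\<rparr>"
  shows "on1 V (act B) \<odot>\<^bsub>L\<^esub> lam (base_ob B) \<odot>\<^bsub>L\<^esub> on1 (endo R) (on1 V f)
      = on1 V (act B) \<odot>\<^bsub>L\<^esub> on1 V (on1 (endo T) f) \<odot>\<^bsub>L\<^esub> lam (base_ob A)"
    "on2 V \<phi> \<lhd>\<^bsub>L\<^esub> lam (base_ob A)
      \<in> hom2 L (on1 V (act B) \<odot>\<^bsub>L\<^esub> on1 V (on1 (endo T) f) \<odot>\<^bsub>L\<^esub> lam (base_ob A))
          (on1 V f \<odot>\<^bsub>L\<^esub> on1 V (act A) \<odot>\<^bsub>L\<^esub> lam (base_ob A))"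
  using S.psmor_cells[OF assms] by (simp_all add: hom2_def lam_natural1)

end

theorem proposition6p3:
  fixes K :: "('o, 'm, 'c) two_cat" and T :: "('o, 'm, 'c) monad_data"
    and L :: "('p, 'n, 'd) two_cat" and R :: "('p, 'n, 'd) monad_data"
    and V :: "('o, 'm, 'c, 'p, 'n, 'd) two_map" and lam :: "'o \<Rightarrow> 'n"
  assumes "two_monad K T" and "two_monad L R"
    and "colax_monad_morphism K T L R V lam"
  shows
    "two_functor (PsAlg K T) (PsAlg L R) (restrict_ps T L R V lam) \<and>
     map_eq_on (PsAlg K T) (comp_map forget (restrict_ps T L R V lam)) (comp_map V forget) \<and>
     (\<forall>X a \<iota> \<chi>. \<lparr>base_ob = X, act = a, unit_cell = \<iota>, mult_cell = \<chi>\<rparr> \<in> obj (PsAlg K T) \<longrightarrow>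
        (let c = on1 V a \<odot>\<^bsub>L\<^esub> lam X;
             \<Lambda> = lam (on0 (endo T) X) \<odot>\<^bsub>L\<^esub> on1 (endo R) (lam X) in
         on0 (restrict_ps T L R V lam) \<lparr>base_ob = X, act = a, unit_cell = \<iota>, mult_cell = \<chi>\<rparr>
           = \<lparr>base_ob = on0 V X, act = c, unit_cell = on2 V \<iota>, mult_cell = on2 V \<chi> \<lhd>\<^bsub>L\<^esub> \<Lambda>\<rparr> \<and>
         c \<in> hom1 L (on0 (endo R) (on0 V X)) (on0 V X) \<and>
         on2 V \<iota> \<in> hom2 L (id1 L (on0 V X)) (c \<odot>\<^bsub>L\<^esub> eta R (on0 V X)) \<and>
         c \<odot>\<^bsub>L\<^esub> on1 (endo R) c = on1 V a \<odot>\<^bsub>L\<^esub> on1 V (on1 (endo T) a) \<odot>\<^bsub>L\<^esub> \<Lambda> \<and>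
         on2 V \<chi> \<lhd>\<^bsub>L\<^esub> \<Lambda> \<in> hom2 L (on1 V a \<odot>\<^bsub>L\<^esub> on1 V (on1 (endo T) a) \<odot>\<^bsub>L\<^esub> \<Lambda>)
                                (on1 V a \<odot>\<^bsub>L\<^esub> on1 V (mu T X) \<odot>\<^bsub>L\<^esub> \<Lambda>) \<and>
         on1 V a \<odot>\<^bsub>L\<^esub> on1 V (mu T X) \<odot>\<^bsub>L\<^esub> \<Lambda> = c \<odot>\<^bsub>L\<^esub> mu R (on0 V X))) \<and>
     (\<forall>A B f \<phi>. \<lparr>msrc = A, mmap = f, mcell = \<phi>, mtrg = B\<rparr> \<in> cell1 (PsAlg K T) \<longrightarrow>
        on1 (restrict_ps T L R V lam) \<lparr>msrc = A, mmap = f, mcell = \<phi>, mtrg = B\<rparr>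
          = \<lparr>msrc = on0 (restrict_ps T L R V lam) A, mmap = on1 V f,
             mcell = on2 V \<phi> \<lhd>\<^bsub>L\<^esub> lam (base_ob A), mtrg = on0 (restrict_ps T L R V lam) B\<rparr> \<and>
        on1 V (act B) \<odot>\<^bsub>L\<^esub> lam (base_ob B) \<odot>\<^bsub>L\<^esub> on1 (endo R) (on1 V f)
          = on1 V (act B) \<odot>\<^bsub>L\<^esub> on1 V (on1 (endo T) f) \<odot>\<^bsub>L\<^esub> lam (base_ob A) \<and>
        on2 V \<phi> \<lhd>\<^bsub>L\<^esub> lam (base_ob A)
          \<in> hom2 L (on1 V (act B) \<odot>\<^bsub>L\<^esub> on1 V (on1 (endo T) f) \<odot>\<^bsub>L\<^esub> lam (base_ob A))
                   (on1 V f \<odot>\<^bsub>L\<^esub> on1 V (act A) \<odot>\<^bsub>L\<^esub> lam (base_ob A))) \<and>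
     (\<forall>p q \<alpha>. \<lparr>tsrc = p, tcell = \<alpha>, ttrg = q\<rparr> \<in> cell2 (PsAlg K T) \<longrightarrow>
        on2 (restrict_ps T L R V lam) \<lparr>tsrc = p, tcell = \<alpha>, ttrg = q\<rparr>
          = \<lparr>tsrc = on1 (restrict_ps T L R V lam) p, tcell = on2 V \<alpha>,
             ttrg = on1 (restrict_ps T L R V lam) q\<rparr>) \<and>
     (\<forall>A. normal_psalg K T A \<longrightarrow> normal_psalg L R (on0 (restrict_ps T L R V lam) A))"
proof -
  interpret colax_monad_morphism K T L R V lam by fact
  show ?thesis
    \<comment> \<open>Membership in the carriers becomes the defining predicates, so the typing
      claims follow from the two explicit lemmas. The record equations need the restrictions
      unfolded; normality is settled beforehand, while they are still folded.\<close>
    unfolding Let_def PsAlg_simps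
    by (intro conjI allI impI two_functor_restrict_ps restrict_ps_over;
      (erule restrict_action restrict_comparison)?)
      (simp_all add: normal_psalg_restrict, simp_all add: restrict_psalg_def restrict_psmor_def)
qed

end
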